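(* Suppose that for every non-spherical connected free of infinity Coxeter graph $\Gamma$ we have $Z(A_\Gamma)=\{1\}$. Then for every non-spherical connected Coxeter graph $\Gamma$ we have $Z(A_\Gamma)=\{1\}$.
   Context: Let $S$ be a finite set. A Coxeter matrix over $S$ is a square matrix $M=(m_{s,t})_{s,t\in S}$ with $m_{s,s}=1$ for all $s\in S$ and $m_{s,t}=m_{t,s}\in\{2,3,4,\dots,\infty\}$ for all $s\neq t$ in $S$. It is represented by its Coxeter graph $\Gamma$: the labeled graph with vertex set $S$ in which two vertices $s,t$ are joined by an edge if $m_{s,t}\ge 3$ (including $m_{s,t}=\infty$), this edge being labeled by $m_{s,t}$ if $m_{s,t}\ge 4$. All Coxeter graphs have finite vertex set. "Connected" refers to connectedness of this graph. The Coxeter group of type $\Gamma$ is $$W_\Gamma=\langle S\mid s^2=1 \text{ for } s\in S,\ (st)^{m_{s,t}}=1 \text{ for } s,t\in S,\ s\neq t,\ m_{s,t}\neq\infty\rangle.$$ For two letters $a,b$ and an integer $m\ge 2$, set $\Pi(a,b:m)=(ab)^{m/2}$ if $m$ is even and $\Pi(a,b:m)=(ab)^{(m-1)/2}a$ if $m$ is odd. Let $\Sigma=\{\sigma_s ; s\in S\}$ be a set in one-to-one correspondence with $S$. The Artin-Tits group of type $\Gamma$ is $$A_\Gamma=\langle \Sigma \mid \Pi(\sigma_s,\sigma_t:m_{s,t})=\Pi(\sigma_t,\sigma_s:m_{s,t}) \text{ for } s,t\in S,\ s\neq t,\ m_{s,t}\neq\infty\rangle.$$ A Coxeter graph $\Gamma$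 is of spherical type if $W_\Gamma$ is finite, and non-spherical otherwise. It is free of infinity if $m_{s,t}\neq\infty$ for all $s,t\in S$, $s\neq t$. $Z(G)$ denotes the center of a group $G$. *)

theory Defs
  imports "HOL-Library.Extended_Nat" "HOL-Algebra.Group"
begin

section \<open>Groups given by generators and relations\<close>

text \<open>
  A letter \<open>(x, True)\<close> stands for the generator \<open>x\<close>, and \<open>(x, False)\<close> for its formal inverse.
  A relation \<open>l = r\<close> is the pair \<open>(l, r)\<close>. The group \<open>\<langle>X | R\<rangle>\<close> consists of the words over the
  letters of \<open>X\<close> modulo the least congruence that contains \<open>R\<close> and the free cancellations.
\<close>

type_synonym 'a group_word = "('a \<times> bool) list"

definition group_words :: "'a set \<Rightarrow> 'a group_word set" where
  "group_words X = lists (X \<times> UNIV)"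

inductive_set presentation_cong ::
    "'a set \<Rightarrow> ('a group_word \<times> 'a group_word) set \<Rightarrow> ('a group_word \<times> 'a group_word) set"
  for X R where
  refl: "u \<in> group_words X \<Longrightarrow> (u, u) \<in> presentation_cong X R"
| sym: "(u, v) \<in> presentation_cong X R \<Longrightarrow> (v, u) \<in> presentation_cong X R"
| trans: "(u, v) \<in> presentation_cong X R \<Longrightarrow> (v, w) \<in> presentation_cong X R \<Longrightarrow>
    (u, w) \<in> presentation_cong X R"
| cancel: "u \<in> group_words X \<Longrightarrow> v \<in> group_words X \<Longrightarrow> x \<in> X \<Longrightarrow>
    (u @ [(x, e), (x, \<not> e)] @ v, u @ v) \<in> presentation_cong X R"
| relation: "u \<in> group_words X \<Longrightarrow> v \<in> group_words X \<Longrightarrow> (l, r) \<in> R \<Longrightarrow>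
    l \<in> group_words X \<Longrightarrow> r \<in> group_words X \<Longrightarrow>
    (u @ l @ v, u @ r @ v) \<in> presentation_cong X R"

definition presented_group ::
    "'a set \<Rightarrow> ('a group_word \<times> 'a group_word) set \<Rightarrow> 'a group_word set monoid" where
  "presented_group X R =
    \<lparr>carrier = group_words X // presentation_cong X R,
     mult = (\<lambda>A B. \<Union>u\<in>A. \<Union>v\<in>B. presentation_cong X R `` {u @ v}),
     one = presentation_cong X R `` {[]}\<rparr>"

lemma group_words_simps [simp]:
  "[] \<in> group_words X"
  "p # u \<in> group_words X \<longleftrightarrow> fst p \<in> X \<and> u \<in> group_words X"
  "u @ v \<in> group_words X \<longleftrightarrow> u \<in> group_words X \<and> v \<in> group_words X"
  by (cases p; auto simp: group_words_def)+

lemma presentation_cong_words: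
  "(u, v) \<in> presentation_cong X R \<Longrightarrow> u \<in> group_words X \<and> v \<in> group_words X"
  by (induction rule: presentation_cong.induct) auto

lemma equiv_presentation_cong: "equiv (group_words X) (presentation_cong X R)"
  by (rule equivI)
    (auto intro!: refl_onI symI transI intro: presentation_cong.intros
      dest: presentation_cong_words)

lemma presentation_cong_append_left:
  assumes "(u, v) \<in> presentation_cong X R" "w \<in> group_words X"
  shows "(w @ u, w @ v) \<in> presentation_cong X R"
  using assms
proof (induction rule: presentation_cong.induct)
  case (cancel u v x e)
  then show ?case using presentation_cong.cancel[of "w @ u" X v x e R] by simp
next
  case (relation u v l r)
  then show ?case using presentation_cong.relation[of "w @ u" X v l r R] by simp
qed (auto intro: presentation_cong.refl presentation_cong.sym presentation_cong.trans)

lemma presentation_cong_append_right: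
  assumes "(u, v) \<in> presentation_cong X R" "w \<in> group_words X"
  shows "(u @ w, v @ w) \<in> presentation_cong X R"
  using assms
proof (induction rule: presentation_cong.induct)
  case (cancel u v x e)
  then show ?case using presentation_cong.cancel[of u X "v @ w" x e R] by simp
next
  case (relation u v l r)
  then show ?case using presentation_cong.relation[of u X "v @ w" l r R] by simp
qed (auto intro: presentation_cong.refl presentation_cong.sym presentation_cong.trans)

lemma presentation_cong_append:
  assumes "(u, u') \<in> presentation_cong X R" "(v, v') \<in> presentation_cong X R"
  shows "(u @ v, u' @ v') \<in> presentation_cong X R"
  using assms presentation_cong_words presentation_cong.trans
    presentation_cong_append_left presentation_cong_append_right
  by metis

lemma presented_group_mult_class:
  assumes "u \<in> group_words X" "v \<in> group_words X"
  shows "presentation_cong X R `` {u} \<otimes>\<^bsub>presented_group X R\<^esub> presentation_cong X R `` {v} =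
    presentation_cong X R `` {u @ v}"
proof -
  have "congruent2 (presentation_cong X R) (presentation_cong X R)
      (\<lambda>u v. presentation_cong X R `` {u @ v})"
    by (rule congruent2I')
      (rule equiv_class_eq[OF equiv_presentation_cong presentation_cong_append])
  from UN_equiv_class2[OF equiv_presentation_cong equiv_presentation_cong this assms]
  show ?thesis by (simp add: presented_group_def)
qed

lemma presentation_cong_inverse:
  assumes "u \<in> group_words X"
  shows "(rev (map (apsnd Not) u) @ u, []) \<in> presentation_cong X R"
  using assms
proof (induction u)
  case (Cons p u)
  obtain x e where p: "p = (x, e)" by (cases p)
  have w: "rev (map (apsnd Not) u) \<in> group_words X" if "u \<in> group_words X" for u
    using that by (induction u) auto
  from Cons.prems p have "(rev (map (apsnd Not) u) @ [(x, \<not> e), (x, \<not> \<not> e)] @ u,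
      rev (map (apsnd Not) u) @ u) \<in> presentation_cong X R"
    by (intro presentation_cong.cancel) (auto simp: w)
  with Cons p show ?case by (auto intro: presentation_cong.trans)
qed (auto intro: presentation_cong.refl)

theorem group_presented_group: "group (presented_group X R)"
proof (rule groupI)
  have carrier: "\<exists>u\<in>group_words X. A = presentation_cong X R `` {u}"
    if "A \<in> carrier (presented_group X R)" for A
    using that by (auto simp: presented_group_def quotient_def)
  have class_carrier: "presentation_cong X R `` {u} \<in> carrier (presented_group X R)"
    if "u \<in> group_words X" for u
    using that by (auto simp: presented_group_def quotient_def)
  have one: "\<one>\<^bsub>presented_group X R\<^esub> = presentation_cong X R `` {[]}"
    by (simp add: presented_group_def)
  note [simp] = presented_group_mult_class
  show "\<one>\<^bsub>presented_group X R\<^esub> \<in> carrier (presented_group X R)"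
    by (simp add: one class_carrier)
  show "A \<otimes>\<^bsub>presented_group X R\<^esub> B \<in> carrier (presented_group X R)"
    if "A \<in> carrier (presented_group X R)" "B \<in> carrier (presented_group X R)" for A B
    using that[THEN carrier] by (auto intro!: class_carrier)
  show "A \<otimes>\<^bsub>presented_group X R\<^esub> B \<otimes>\<^bsub>presented_group X R\<^esub> C =
      A \<otimes>\<^bsub>presented_group X R\<^esub> (B \<otimes>\<^bsub>presented_group X R\<^esub> C)"
    if "A \<in> carrier (presented_group X R)" "B \<in> carrier (presented_group X R)"
      "C \<in> carrier (presented_group X R)" for A B C
    using that[THEN carrier] by auto
  show "\<one>\<^bsub>presented_group X R\<^esub> \<otimes>\<^bsub>presented_group X R\<^esub> A = A"
    if "A \<in> carrier (presented_group X R)" for A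
    using that[THEN carrier] by (auto simp: one)
  show "\<exists>B\<in>carrier (presented_group X R).
      B \<otimes>\<^bsub>presented_group X R\<^esub> A = \<one>\<^bsub>presented_group X R\<^esub>"
    if "A \<in> carrier (presented_group X R)" for A
  proof -
    from carrier[OF that] obtain u
      where u: "u \<in> group_words X" and A: "A = presentation_cong X R `` {u}" by blast
    let ?v = "rev (map (apsnd Not) u)"
    from u have v: "?v \<in> group_words X" by (induction u) auto
    have "presentation_cong X R `` {?v @ u} = presentation_cong X R `` {[]}"
      by (rule equiv_class_eq[OF equiv_presentation_cong presentation_cong_inverse[OF u]])
    with u v A show ?thesis
      by (intro bexI[OF _ class_carrier[OF v]]) (simp add: one)
  qed
qed

definition group_center :: "('a, 'b) monoid_scheme \<Rightarrow> 'a set" where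
  "group_center G = {z \<in> carrier G. \<forall>g\<in>carrier G. z \<otimes>\<^bsub>G\<^esub> g = g \<otimes>\<^bsub>G\<^esub> z}"

section \<open>Coxeter graphs\<close>

text \<open>
  A Coxeter graph is given by its vertex set \<open>S\<close> and its Coxeter matrix \<open>M\<close>, where the entry
  \<open>\<infinity>\<close> is a value of \<^typ>\<open>enat\<close>. Entries of \<open>M\<close> outside \<open>S\<close> are irrelevant.
\<close>

definition coxeter_matrix :: "'a set \<Rightarrow> ('a \<Rightarrow> 'a \<Rightarrow> enat) \<Rightarrow> bool" where
  "coxeter_matrix S M \<longleftrightarrow> finite S \<and> (\<forall>s\<in>S. M s s = 1) \<and>
    (\<forall>s\<in>S. \<forall>t\<in>S. s \<noteq> t \<longrightarrow> M s t = M t s \<and> 2 \<le> M s t)"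

definition coxeter_edges :: "'a set \<Rightarrow> ('a \<Rightarrow> 'a \<Rightarrow> enat) \<Rightarrow> ('a \<times> 'a) set" where
  "coxeter_edges S M = {(s, t). s \<in> S \<and> t \<in> S \<and> s \<noteq> t \<and> 3 \<le> M s t}"

text \<open>The empty graph counts as connected here; it is of spherical type.\<close>

definition coxeter_connected :: "'a set \<Rightarrow> ('a \<Rightarrow> 'a \<Rightarrow> enat) \<Rightarrow> bool" where
  "coxeter_connected S M \<longleftrightarrow> (\<forall>s\<in>S. \<forall>t\<in>S. (s, t) \<in> (coxeter_edges S M)\<^sup>*)"

definition free_of_infinity :: "'a set \<Rightarrow> ('a \<Rightarrow> 'a \<Rightarrow> enat) \<Rightarrow> bool" where
  "free_of_infinity S M \<longleftrightarrow> (\<forall>s\<in>S. \<forall>t\<in>S. s \<noteq> t \<longrightarrow> M s t \<noteq> \<infinity>)"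

section \<open>Coxeter groups and Artin-Tits groups\<close>

definition coxeter_relations ::
    "'a set \<Rightarrow> ('a \<Rightarrow> 'a \<Rightarrow> enat) \<Rightarrow> ('a group_word \<times> 'a group_word) set" where
  "coxeter_relations S M =
    {([(s, True), (s, True)], []) | s. s \<in> S} \<union>
    {(concat (replicate m [(s, True), (t, True)]), []) | s t m.
      s \<in> S \<and> t \<in> S \<and> s \<noteq> t \<and> M s t = enat m}"

definition coxeter_group :: "'a set \<Rightarrow> ('a \<Rightarrow> 'a \<Rightarrow> enat) \<Rightarrow> 'a group_word set monoid" where
  "coxeter_group S M = presented_group S (coxeter_relations S M)"

definition spherical_type :: "'a set \<Rightarrow> ('a \<Rightarrow> 'a \<Rightarrow> enat) \<Rightarrow> bool" where
  "spherical_type S M \<longleftrightarrow> finite (carrier (coxeter_group S M))"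

definition alternating_word :: "'b \<Rightarrow> 'b \<Rightarrow> nat \<Rightarrow> 'b list" where
  "alternating_word a b m =
    (if even m then concat (replicate (m div 2) [a, b])
     else concat (replicate ((m - 1) div 2) [a, b]) @ [a])"

text \<open>The vertex \<open>s\<close> itself serves as the name of the generator \<open>\<sigma>\<^sub>s\<close>.\<close>

definition artin_relations ::
    "'a set \<Rightarrow> ('a \<Rightarrow> 'a \<Rightarrow> enat) \<Rightarrow> ('a group_word \<times> 'a group_word) set" where
  "artin_relations S M =
    {(alternating_word (s, True) (t, True) m, alternating_word (t, True) (s, True) m) | s t m.
      s \<in> S \<and> t \<in> S \<and> s \<noteq> t \<and> M s t = enat m}"

definition artin_group :: "'a set \<Rightarrow> ('a \<Rightarrow> 'a \<Rightarrow> enat) \<Rightarrow> 'a group_word set monoid" where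
  "artin_group S M = presented_group S (artin_relations S M)"

end

theory Submission
  imports Defs Complex_Main "HOL-Library.Countable_Set"
begin

text \<open>
  For graphs that are free of infinity the claim is the hypothesis, up to a renaming of the
  vertices. The content is the case of an infinite label \<open>M s t = \<infinity>\<close>. Write \<open>A\<^sub>X\<close> for
  the subgroup of \<open>A = A\<^sub>S\<close> generated by a set \<open>X\<close> of vertices.

  First, \<open>A\<close> is the amalgam of \<open>A\<^sub>S\<^sub>-\<^sub>s\<close> and \<open>A\<^sub>S\<^sub>-\<^sub>t\<close> over \<open>A\<^sub>X\<close> with
  \<open>X = S - {s, t}\<close>, and both factors are larger than \<open>A\<^sub>X\<close>. As in every such amalgam, the centre
  lies in the base: \<open>Z(A) \<subseteq> A\<^sub>X\<close> (theorem \<open>center_subset_base\<close>). This is shown by a ping-pong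
  action (lemmas \<open>ping_pong_center\<close> and \<open>coset_action_extension\<close>) in place of normal forms.

  Second, in a connected graph no nontrivial central element lies in \<open>A\<^sub>X\<close> for a proper subset
  \<open>X\<close> (theorem \<open>center_inter_proper_parabolic\<close>). The key is that an element of \<open>A\<^sub>X\<close> which commutes
  with a generator \<open>t\<close> outside \<open>X\<close> lies in \<open>A\<^sub>Y\<close>, where \<open>Y\<close> consists of the vertices of \<open>X\<close> that are
  not joined to \<open>t\<close> (theorem \<open>commuting_generator_parabolic\<close>). As long as \<open>X\<close> is not empty, some
  \<open>t\<close> outside \<open>X\<close> is joined to a vertex of \<open>X\<close>, so that \<open>X\<close> can be made smaller.

  The key is read off a map of sets \<open>A \<rightarrow> A\<^sub>X\<close> that is the identity on \<open>A\<^sub>X\<close>. It follows a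
  word through the cosets of \<open>W\<^sub>X\<close> in a reflection group and records the letters that fix the
  current coset, after conjugation into \<open>X\<close>. That the result respects the
  braid relations (lemma \<open>retraction_relation\<close>) rests on the theorem of Tits that every root
  has coordinates of one sign (theorem \<open>root_nonneg_or_nonpos\<close>): it controls how the
  roots of \<open>X\<close> can meet the plane of two simple roots.
\<close>

section \<open>Alternating words\<close>

lemma alternating_word_simps [simp]:
  "alternating_word a b 0 = []"
  "alternating_word a b (Suc n) = a # alternating_word b a n"
proof -
  show "alternating_word a b 0 = []" by (simp add: alternating_word_def)
  have rot: "concat (replicate k [a, b]) @ [a] = a # concat (replicate k [b, a])" for k and a b :: 'c
    by (induction k) auto
  show "alternating_word a b (Suc n) = a # alternating_word b a n"
  proof (cases "even n")
    case True
    then show ?thesis by (simp add: alternating_word_def rot)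
  next
    case False
    then obtain k where n: "n = Suc (2 * k)" by (auto elim: oddE)
    have "alternating_word a b (Suc n) = a # b # concat (replicate k [a, b])"
      by (simp add: alternating_word_def n)
    also have "\<dots> = a # alternating_word b a n"
      by (simp add: alternating_word_def n rot)
    finally show ?thesis .
  qed
qed

lemma alternating_word_snoc:
  "alternating_word a b (Suc n) = alternating_word a b n @ [if even n then a else b]"
  by (induction n arbitrary: a b) auto

lemma length_alternating_word [simp]: "length (alternating_word a b n) = n"
  by (induction n arbitrary: a b) auto

lemma set_alternating_word: "set (alternating_word a b n) \<subseteq> {a, b}"
proof (induction n arbitrary: a b)
  case (Suc n)
  from Suc.IH[of b a] show ?case by auto
qed simp

lemma map_alternating_word: "map f (alternating_word a b n) = alternating_word (f a) (f b) n"
  by (induction n arbitrary: a b) auto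

lemma alternating_word_add:
  "alternating_word a b (k + n) = alternating_word a b k @
     (if even k then alternating_word a b n else alternating_word b a n)"
  by (induction k arbitrary: a b) auto

lemma rev_alternating_word:
  "rev (alternating_word a b n) = (if even n then alternating_word b a n else alternating_word a b n)"
proof (induction n arbitrary: a b)
  case (Suc n)
  have "rev (alternating_word a b (Suc n)) = rev (alternating_word b a n) @ [a]" by simp
  also have "\<dots> = (if even n then alternating_word a b n else alternating_word b a n) @ [a]"
    by (simp add: Suc.IH)
  also have "\<dots> = (if even (Suc n) then alternating_word b a (Suc n) else alternating_word a b (Suc n))"
    by (simp add: alternating_word_snoc del: alternating_word_simps)
  finally show ?case .
qed simp

lemma not_distinct_adjD: "\<not> distinct_adj l \<Longrightarrow> \<exists>u a v. l = u @ [a, a] @ v"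
proof (induction l)
  case (Cons x l)
  show ?case
  proof (cases "distinct_adj l")
    case True
    with Cons.prems obtain l' where "l = x # l'" by (cases l) auto
    then show ?thesis by (intro exI[of _ "[]"]) simp
  next
    case False
    with Cons.IH obtain u a v where "l = u @ [a, a] @ v" by blast
    then show ?thesis by (intro exI[of _ "x # u"]) simp
  qed
qed simp

lemma distinct_adj_two_letters:
  assumes "set l \<subseteq> {s, t}" "distinct_adj l" "s \<noteq> t"
  shows "\<exists>a b n. {a, b} = {s, t} \<and> l = alternating_word a b n"
  using assms(1,2)
proof (induction l)
  case Nil
  show ?case by (intro exI[of _ s] exI[of _ t] exI[of _ 0]) simp
next
  case (Cons x l)
  then obtain a b n where ab: "{a, b} = {s, t}" "l = alternating_word a b n"
    by (auto dest: distinct_adj_ConsD)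
  show ?case
  proof (cases n)
    case 0
    have "{x, if x = s then t else s} = {s, t}" using Cons.prems(1) by auto
    with 0 ab show ?thesis
      by (intro exI[of _ x] exI[of _ "if x = s then t else s"] exI[of _ 1]) simp
  next
    case (Suc n')
    with ab Cons.prems have "x \<noteq> a" "x \<in> {s, t}" by auto
    with ab(1) assms(3) have "x = b" by blast
    with ab have "{b, a} = {s, t}" "x # l = alternating_word b a (Suc n)" by auto
    then show ?thesis by blast
  qed
qed

section \<open>The geometric representation and the signs of roots\<close>

text \<open>
  With \<open>h = \<pi> / m\<close> this is \<open>U\<^sub>k\<^sub>-\<^sub>1 (cos h)\<close>, a Chebyshev polynomial of the second kind. Two
  consecutive values are the coordinates of a root of the dihedral group of order \<open>2 m\<close> in
  terms of its two simple roots.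
\<close>

definition chebyshev_sine :: "nat \<Rightarrow> nat \<Rightarrow> real" where
  "chebyshev_sine m k = sin (real k * (pi / real m)) / sin (pi / real m)"

definition simple_root :: "'a \<Rightarrow> 'a \<Rightarrow> real" where
  "simple_root s = (\<lambda>x. if x = s then 1 else 0)"

lemma sin_pi_over_pos: "2 \<le> m \<Longrightarrow> 0 < sin (pi / real m)"
  by (intro sin_gt_zero) (auto simp: field_simps)

lemma chebyshev_sine_0 [simp]: "chebyshev_sine m 0 = 0"
  by (simp add: chebyshev_sine_def)

lemma chebyshev_sine_1 [simp]: "2 \<le> m \<Longrightarrow> chebyshev_sine m (Suc 0) = 1"
  using sin_pi_over_pos[of m] by (simp add: chebyshev_sine_def)

lemma chebyshev_sine_rec:
  "chebyshev_sine m (Suc (Suc k)) =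
     2 * cos (pi / real m) * chebyshev_sine m (Suc k) - chebyshev_sine m k"
proof -
  define h where "h = pi / real m"
  have "sin (real (Suc (Suc k)) * h) + sin (real k * h) = 2 * cos h * sin (real (Suc k) * h)"
    using sin_plus_sin[of "real (Suc (Suc k)) * h" "real k * h"]
    by (simp add: algebra_simps add_divide_distrib)
  then have "sin (real (Suc (Suc k)) * h) = 2 * cos h * sin (real (Suc k) * h) - sin (real k * h)"
    by simp
  then show ?thesis
    unfolding chebyshev_sine_def h_def[symmetric] by (simp add: diff_divide_distrib)
qed

lemma chebyshev_sine_nonneg:
  assumes "2 \<le> m" "k \<le> m"
  shows "0 \<le> chebyshev_sine m k"
proof -
  have "real k * (pi / real m) \<le> pi"
    using assms by (simp add: field_simps mult_right_mono)
  then have "0 \<le> sin (real k * (pi / real m))"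
    by (intro sin_ge_zero) auto
  with sin_pi_over_pos[OF assms(1)] show ?thesis by (simp add: chebyshev_sine_def)
qed

lemma chebyshev_sine_reflect:
  assumes "2 \<le> m" "k \<le> m"
  shows "chebyshev_sine m (m - k) = chebyshev_sine m k"
proof -
  have "real (m - k) * (pi / real m) = pi - real k * (pi / real m)"
    using assms by (simp add: of_nat_diff field_simps)
  then show ?thesis by (simp add: chebyshev_sine_def)
qed

lemma cos_pi_over_inj:
  assumes "1 \<le> m" "1 \<le> n" "cos (pi / real m) = cos (pi / real n)"
  shows "m = n"
proof -
  have "pi / real k \<le> pi" if "1 \<le> k" for k :: nat
    using that divide_left_mono[of 1 "real k" pi] by simp
  then have "pi / real m = pi / real n"
    using assms(1,2) by (intro cos_inj_pi[OF _ _ _ _ assms(3)]) simp_all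
  then show ?thesis using assms(1,2) by simp
qed

text \<open>
  All labels are finite here. A label \<open>\<infinity>\<close> of a Coxeter graph imposes no relation, so it
  will be replaced by a large number: the Artin-Tits group still acts through the reflection
  group obtained in this way.
\<close>

locale finite_coxeter_matrix =
  fixes S :: "'a set" and m :: "'a \<Rightarrow> 'a \<Rightarrow> nat"
  assumes finite_S: "finite S"
    and label_refl: "s \<in> S \<Longrightarrow> m s s = 1"
    and label_sym: "s \<in> S \<Longrightarrow> t \<in> S \<Longrightarrow> m s t = m t s"
    and label_ge_2: "s \<in> S \<Longrightarrow> t \<in> S \<Longrightarrow> s \<noteq> t \<Longrightarrow> 2 \<le> m s t"
begin

text \<open>
  Vectors are real functions on vertices. The symmetric bilinear form \<open>form\<close> has the matrix
  \<open>gram\<close> in the basis of simple roots, and \<open>pair_root s\<close> is its value against the simple root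
  of \<open>s\<close>. The diagonal entries are \<open>- cos \<pi> = 1\<close>, so every root has norm one.
\<close>

definition gram :: "'a \<Rightarrow> 'a \<Rightarrow> real" where
  "gram s t = - cos (pi / real (m s t))"

definition pair_root :: "'a \<Rightarrow> ('a \<Rightarrow> real) \<Rightarrow> real" where
  "pair_root s v = (\<Sum>t\<in>S. gram s t * v t)"

definition form :: "('a \<Rightarrow> real) \<Rightarrow> ('a \<Rightarrow> real) \<Rightarrow> real" where
  "form v w = (\<Sum>s\<in>S. v s * pair_root s w)"

definition reflection :: "'a \<Rightarrow> ('a \<Rightarrow> real) \<Rightarrow> 'a \<Rightarrow> real" where
  "reflection s v = (\<lambda>x. v x - 2 * pair_root s v * simple_root s x)"

lemma gram_sym: "s \<in> S \<Longrightarrow> t \<in> S \<Longrightarrow> gram s t = gram t s"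
  by (simp add: gram_def label_sym)

lemma gram_refl: "s \<in> S \<Longrightarrow> gram s s = 1"
  by (simp add: gram_def label_refl)

lemma pair_root_simple_root: "t \<in> S \<Longrightarrow> pair_root s (simple_root t) = gram s t"
  using finite_S by (simp add: pair_root_def simple_root_def if_distrib[of "(*) _"] cong: if_cong)

lemma pair_root_linear:
  "pair_root s (\<lambda>x. a * v x + c * w x) = a * pair_root s v + c * pair_root s w"
  by (simp add: pair_root_def sum.distrib sum_distrib_left algebra_simps)

lemma pair_root_diff:
  "pair_root s (\<lambda>x. v x - c * w x) = pair_root s v - c * pair_root s w"
  using pair_root_linear[of s 1 v "- c" w] by simp

lemma form_sym: "form v w = form w v"
proof -
  have "form v w = (\<Sum>s\<in>S. \<Sum>t\<in>S. v s * gram s t * w t)"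
    by (simp add: form_def pair_root_def sum_distrib_left mult.assoc)
  also have "\<dots> = (\<Sum>t\<in>S. \<Sum>s\<in>S. v s * gram s t * w t)"
    by (rule sum.swap)
  also have "\<dots> = form w v"
    by (simp add: form_def pair_root_def sum_distrib_left gram_sym mult_ac)
  finally show ?thesis .
qed

lemma form_diff_right: "form v (\<lambda>x. u x - c * w x) = form v u - c * form v w"
  by (simp add: form_def pair_root_diff sum_subtractf sum_distrib_left algebra_simps)

lemma form_diff_left: "form (\<lambda>x. u x - c * w x) v = form u v - c * form w v"
  using form_diff_right[of v u c w] by (simp add: form_sym)

lemma form_simple_root: "s \<in> S \<Longrightarrow> form (simple_root s) v = pair_root s v"
  using finite_S by (simp add: form_def simple_root_def if_distrib[of "\<lambda>x. x * _"] cong: if_cong)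

lemma form_simple_root': "s \<in> S \<Longrightarrow> form v (simple_root s) = pair_root s v"
  by (metis form_simple_root form_sym)

lemma form_refl: "s \<in> S \<Longrightarrow> form (reflection s v) (reflection s w) = form v w"
  unfolding reflection_def
  by (simp add: form_diff_left form_diff_right form_simple_root form_simple_root'
      pair_root_simple_root gram_refl)

lemma reflection_linear: "reflection s (\<lambda>x. a * v x + c * w x) = (\<lambda>x. a * reflection s v x + c * reflection s w x)"
  by (rule ext) (simp add: reflection_def pair_root_linear algebra_simps)

lemma reflection_involutive [simp]: "s \<in> S \<Longrightarrow> reflection s (reflection s v) = v"
  by (rule ext) (simp add: reflection_def pair_root_diff pair_root_simple_root gram_refl)

lemma reflection_simple_root: "t \<in> S \<Longrightarrow>
    reflection s (simple_root t) = (\<lambda>x. simple_root t x - 2 * gram s t * simple_root s x)"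
  by (simp add: reflection_def pair_root_simple_root)

lemma reflection_own_root: "s \<in> S \<Longrightarrow> reflection s (simple_root s) = (\<lambda>x. - simple_root s x)"
  by (simp add: reflection_simple_root gram_refl)

abbreviation word_map :: "'a list \<Rightarrow> ('a \<Rightarrow> real) \<Rightarrow> 'a \<Rightarrow> real" where
  "word_map ls \<equiv> foldr reflection ls"

lemma word_map_append: "word_map (k @ l) = word_map k \<circ> word_map l"
  by (simp add: fun_eq_iff)

lemma word_map_linear:
  "word_map ls (\<lambda>x. a * v x + c * w x) = (\<lambda>x. a * word_map ls v x + c * word_map ls w x)"
  by (induction ls) (simp_all add: reflection_linear)

lemma word_map_scale: "word_map ls (\<lambda>x. a * v x) = (\<lambda>x. a * word_map ls v x)"
  using word_map_linear[of ls a v 0 v] by simp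

lemma word_map_uminus: "word_map ls (\<lambda>x. - v x) = (\<lambda>x. - word_map ls v x)"
  using word_map_scale[of ls "-1" v] by simp

lemma word_map_diff: "word_map ls (\<lambda>x. v x - c * w x) = (\<lambda>x. word_map ls v x - c * word_map ls w x)"
  using word_map_linear[of ls 1 v "- c" w] by simp

lemma word_map_rev: "ls \<in> lists S \<Longrightarrow> word_map (rev ls) (word_map ls v) = v"
  by (induction ls arbitrary: v) auto

lemma word_map_rev': "ls \<in> lists S \<Longrightarrow> word_map ls (word_map (rev ls) v) = v"
  using word_map_rev[of "rev ls" v] by (auto simp: in_lists_conv_set)

lemma word_map_form: "ls \<in> lists S \<Longrightarrow> form (word_map ls v) (word_map ls w) = form v w"
  by (induction ls) (auto simp: form_refl)

text \<open>
  The roots met along an alternating word run through the positive roots of a dihedral group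
  in their circular order: each application of a reflection is one step of the recursion for
  \<open>sin (k h)\<close>.
\<close>

lemma alternating_root:
  assumes "a \<in> S" "b \<in> S" "a \<noteq> b"
  shows "word_map (alternating_word a b k) (simple_root (if even k then a else b)) =
    (\<lambda>x. chebyshev_sine (m a b) (Suc k) * simple_root a x + chebyshev_sine (m a b) k * simple_root b x)"
  using assms
proof (induction k arbitrary: a b)
  case 0
  then show ?case using label_ge_2[of a b] by simp
next
  case (Suc k)
  define c where "c = chebyshev_sine (m a b)"
  have eq: "m b a = m a b" using label_sym Suc.prems by simp
  have rec: "c (Suc (Suc k)) = - (2 * gram a b * c (Suc k)) - c k"
    unfolding c_def chebyshev_sine_rec gram_def by simp
  have IH: "word_map (alternating_word b a k) (simple_root (if even k then b else a)) =
      (\<lambda>x. c (Suc k) * simple_root b x + c k * simple_root a x)"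
    using Suc.IH[OF Suc.prems(2,1) Suc.prems(3)[symmetric]] by (simp only: c_def eq)
  have "word_map (alternating_word a b (Suc k)) (simple_root (if even (Suc k) then a else b)) =
      reflection a (\<lambda>x. c (Suc k) * simple_root b x + c k * simple_root a x)"
    using IH by (auto split: if_splits)
  also have "\<dots> = (\<lambda>x. c (Suc (Suc k)) * simple_root a x + c (Suc k) * simple_root b x)"
    unfolding rec reflection_linear
    using Suc.prems by (simp add: reflection_simple_root gram_refl algebra_simps fun_eq_iff)
  finally show ?case by (simp add: c_def)
qed

text \<open>
  The two alternating words of length \<open>k\<close> act almost in the same way, up to a multiple of
  \<open>sin (k \<pi> / m)\<close>. Stated for all \<open>k\<close> this is a routine induction, and for \<open>k = m\<close> the
  difference vanishes, which is the braid relation on the whole space.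
\<close>

lemma alternating_word_map_diff:
  assumes "a \<in> S" "b \<in> S" "a \<noteq> b"
  shows "word_map (alternating_word a b k) v x - word_map (alternating_word b a k) v x =
    - 2 * chebyshev_sine (m a b) k *
      (if even k then pair_root b v * simple_root a x - pair_root a v * simple_root b x
       else pair_root a v * simple_root a x - pair_root b v * simple_root b x)"
proof (induction k)
  case (Suc k)
  define c where "c = chebyshev_sine (m a b)"
  have eq: "m b a = m a b" using label_sym assms by simp
  have step: "word_map (alternating_word a' b' (Suc k)) v x =
      word_map (alternating_word a' b' k) v x -
      2 * pair_root (if even k then a' else b') v *
       (c (Suc k) * simple_root a' x + c k * simple_root b' x)"
    if "(a', b') = (a, b) \<or> (a', b') = (b, a)" for a' b'
  proof -
    have "word_map (alternating_word a' b' (Suc k)) v =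
      word_map (alternating_word a' b' k) (reflection (if even k then a' else b') v)"
      unfolding alternating_word_snoc by simp
    then show ?thesis
      using alternating_root[of a' b' k] that assms eq
      by (auto simp: reflection_def word_map_diff c_def)
  qed
  have "word_map (alternating_word a b k) v x = word_map (alternating_word b a k) v x
      - 2 * c k * (if even k then pair_root b v * simple_root a x - pair_root a v * simple_root b x
       else pair_root a v * simple_root a x - pair_root b v * simple_root b x)"
    using Suc.IH by (simp add: c_def)
  then show ?case
    unfolding step[of a b, OF disjI1[OF HOL.refl]] step[of b a, OF disjI2[OF HOL.refl]] c_def[symmetric]
    by (cases "even k") (simp_all add: algebra_simps)
qed simp

lemma braid_relation:
  assumes "a \<in> S" "b \<in> S" "a \<noteq> b"
  shows "word_map (alternating_word a b (m a b)) = word_map (alternating_word b a (m a b))"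
proof -
  have "chebyshev_sine (m a b) (m a b) = 0"
    using chebyshev_sine_reflect[of "m a b" "m a b"] label_ge_2[OF assms] by simp
  then show ?thesis
    using alternating_word_map_diff[OF assms, of "m a b"] by (auto simp: fun_eq_iff)
qed

text \<open>
  This is the argument of Tits. Write the word as \<open>p q\<close> with \<open>q\<close> in the letters \<open>s\<close> and \<open>t\<close>,
  where \<open>t\<close> is the last letter, and \<open>p\<close> as short as possible. Then neither \<open>s\<close> nor \<open>t\<close> shortens
  \<open>p\<close>, so by induction \<open>p\<close> sends both simple roots to nonnegative vectors. As \<open>q\<close> followed by \<open>s\<close>
  cannot be replaced by a word with fewer letters than \<open>q\<close>, it alternates and has at most \<open>m s t\<close> letters; hence \<open>q\<close> sends the simple
  root of \<open>s\<close> to a nonnegative combination of the two simple roots.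
\<close>

lemma root_nonneg_if_not_shortened:
  assumes "ls \<in> lists S" "s \<in> S"
    and "\<And>ls'. ls' \<in> lists S \<Longrightarrow> word_map ls' = word_map (ls @ [s]) \<Longrightarrow> length ls \<le> length ls'"
  shows "0 \<le> word_map ls (simple_root s) x"
  using assms
proof (induction "length ls" arbitrary: ls s x rule: less_induct)
  case less
  show ?case
  proof (cases ls rule: rev_cases)
    case Nil
    then show ?thesis by (simp add: simple_root_def)
  next
    case (snoc ls0 t)
    with less.prems have t: "t \<in> S" "ls0 \<in> lists S" by auto
    have "s \<noteq> t"
    proof
      assume "s = t"
      then have "word_map ls0 = word_map (ls @ [s])"
        using t by (auto simp: snoc)
      from less.prems(3)[OF t(2) this] show False by (simp add: snoc)
    qed
    (* Q k: some factorisation p q with q in s, t has a first part of length k. *)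
    define Q where "Q = (\<lambda>k. \<exists>p\<in>lists S. \<exists>q\<in>lists {s, t}. length p = k \<and>
       word_map (p @ q) = word_map ls \<and> length p + length q \<le> length ls)"
    define k where "k = (LEAST k. Q k)"
    have Q0: "Q (length ls0)"
      unfolding Q_def using t by (intro bexI[of _ ls0] bexI[of _ "[t]"]) (auto simp: snoc)
    then have "Q k" "k \<le> length ls0"
      unfolding k_def by (rule LeastI, rule Least_le)
    then obtain p q where p: "p \<in> lists S" "length p = k" and q: "q \<in> lists {s, t}"
      and pq: "word_map (p @ q) = word_map ls" "length p + length q \<le> length ls"
      unfolding Q_def by auto
    have least: "k \<le> k'" if "Q k'" for k'
      unfolding k_def using that by (rule Least_le)
    have "length p < length ls" using \<open>k \<le> length ls0\<close> p snoc by simp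
    have nonneg: "0 \<le> word_map p (simple_root r) y" if r: "r \<in> {s, t}" for r y
    proof (rule less.hyps[OF \<open>length p < length ls\<close> p(1)])
      show "r \<in> S" using r less.prems t by auto
      fix p' assume p': "p' \<in> lists S" "word_map p' = word_map (p @ [r])"
      show "length p \<le> length p'"
      proof (rule ccontr)
        assume "\<not> ?thesis"
        then have lt: "length p' < length p" by simp
        have "word_map (p' @ (r # q)) = word_map ls"
          using p'(2) pq(1) \<open>r \<in> S\<close> by (simp add: fun_eq_iff)
        then have "Q (length p')"
          unfolding Q_def using p' q r lt pq(2)
          by (intro bexI[of _ p'] bexI[of _ "r # q"]) auto
        from least[OF this] lt p show False by simp
      qed
    qed
    have qS: "q \<in> lists S" using q less.prems(2) t(1) by (auto simp: in_lists_conv_set)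
    have no_short: False
      if "q' \<in> lists S" "word_map q' = word_map (q @ [s])" "length q' < length q" for q'
    proof -
      have "word_map (p @ q') = word_map (ls @ [s])"
        using that(2) arg_cong[OF pq(1), of "\<lambda>f. f \<circ> word_map [s]"]
        by (simp only: word_map_append o_assoc)
      from less.prems(3)[OF _ this] that p pq(2) show False by simp
    qed
    have "distinct_adj (q @ [s])"
    proof (rule ccontr)
      assume "\<not> distinct_adj (q @ [s])"
      then obtain u a v where u: "q @ [s] = u @ [a, a] @ v"
        using not_distinct_adjD by blast
      have "q @ [s] \<in> lists S" using qS less.prems(2) by simp
      then have "u @ v \<in> lists S" "a \<in> S" unfolding u by auto
      moreover have "word_map (u @ v) = word_map (q @ [s])"
        unfolding u using \<open>a \<in> S\<close> by auto
      moreover have "length (u @ v) < length q"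
        using arg_cong[OF u, of length] by simp
      ultimately show False using no_short by blast
    qed
    moreover have "set (q @ [s]) \<subseteq> {s, t}" using q by (auto simp: in_lists_conv_set)
    ultimately obtain a b where ab: "{a, b} = {s, t}"
      "q @ [s] = alternating_word a b (length (q @ [s]))"
      using distinct_adj_two_letters[of "q @ [s]" s t] \<open>s \<noteq> t\<close>
      by (metis length_alternating_word)
    have abS: "a \<in> S" "b \<in> S" "a \<noteq> b"
      using ab(1) less.prems(2) t(1) \<open>s \<noteq> t\<close> by (auto simp: doubleton_eq_iff)
    define j where "j = length q"
    have "q @ [s] = alternating_word a b j @ [if even j then a else b]"
      using ab(2) by (simp add: j_def alternating_word_snoc del: alternating_word_simps)
    then have q_eq: "q = alternating_word a b j" and s_eq: "s = (if even j then a else b)"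
      by auto
    (* Otherwise a braid relation inside q @ [s] creates two equal neighbours. *)
    have "j < m a b"
    proof (rule ccontr)
      assume "\<not> ?thesis"
      then obtain i where i: "j = i + m a b" by (metis le_add_diff_inverse2 not_less)
      define c where "c = (if even i then a else b)"
      define d where "d = (if even i then b else a)"
      have cd: "c \<in> S" "d \<in> S" "c \<noteq> d" "m c d = m a b"
        using abS label_sym by (auto simp: c_def d_def)
      obtain m' where m': "m a b = Suc m'"
        using label_ge_2[OF abS] by (cases "m a b") auto
      have "q @ [s] = alternating_word a b (Suc i + m a b)"
        using ab(2) by (simp add: j_def[symmetric] i)
      also have "\<dots> = alternating_word a b i @ [c] @ alternating_word d c (m c d)"
        unfolding alternating_word_add alternating_word_snoc
        by (auto simp: c_def d_def label_sym abS)
      finally have eq: "q @ [s] = \<dots>" .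
      have "word_map (q @ [s]) = word_map (alternating_word a b i @ [c] @ alternating_word c d (m c d))"
        unfolding eq by (simp only: word_map_append braid_relation[OF cd(1-3)])
      also have "\<dots> = word_map (alternating_word a b i @ alternating_word d c m')"
        using cd by (simp add: m' fun_eq_iff)
      finally have "word_map (alternating_word a b i @ alternating_word d c m') = word_map (q @ [s])"
        by simp
      moreover have "alternating_word a b i @ alternating_word d c m' \<in> lists S"
        using set_alternating_word[of a b i] set_alternating_word[of d c m'] abS cd
        by (auto simp: in_lists_conv_set)
      moreover have "length (alternating_word a b i @ alternating_word d c m') < length q"
        using i m' by (simp add: j_def)
      ultimately show False using no_short by blast
    qed
    have "word_map q (simple_root s) = (\<lambda>x. chebyshev_sine (m a b) (Suc j) * simple_root a x +
        chebyshev_sine (m a b) j * simple_root b x)"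
      unfolding q_eq s_eq using alternating_root[OF abS] .
    then have "word_map ls (simple_root s) = (\<lambda>x. chebyshev_sine (m a b) (Suc j) * word_map p (simple_root a) x +
        chebyshev_sine (m a b) j * word_map p (simple_root b) x)"
      unfolding pq(1)[symmetric] by (simp add: word_map_linear)
    moreover have "0 \<le> word_map p (simple_root a) x" "0 \<le> word_map p (simple_root b) x"
      using nonneg ab(1) by auto
    ultimately show ?thesis
      using \<open>j < m a b\<close> label_ge_2[OF abS]
      by (simp add: chebyshev_sine_nonneg)
  qed
qed

text \<open>
  Compare a shortest word for the group element \<open>w\<close> with a shortest word for \<open>w s\<close>: the
  previous lemma applies to the shorter of the two, and the simple root of \<open>s\<close> changes its
  sign between them.
\<close>

theorem root_nonneg_or_nonpos:
  assumes "ls \<in> lists S" "s \<in> S"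
  shows "(\<forall>x. 0 \<le> word_map ls (simple_root s) x) \<or> (\<forall>x. word_map ls (simple_root s) x \<le> 0)"
proof -
  have shortest: "\<exists>l\<in>lists S. word_map l = word_map l0 \<and>
      (\<forall>l'\<in>lists S. word_map l' = word_map l0 \<longrightarrow> length l \<le> length l')" if "l0 \<in> lists S" for l0
    using that
      ex_has_least_nat[of "\<lambda>l. l \<in> lists S \<and> word_map l = word_map l0" l0 length]
    by blast
  obtain l where l: "l \<in> lists S" "word_map l = word_map ls"
    "\<And>l'. l' \<in> lists S \<Longrightarrow> word_map l' = word_map ls \<Longrightarrow> length l \<le> length l'"
    using shortest[OF assms(1)] by blast
  have "ls @ [s] \<in> lists S" using assms by simp
  from shortest[OF this] obtain k where k: "k \<in> lists S" "word_map k = word_map (ls @ [s])"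
    "\<And>l'. l' \<in> lists S \<Longrightarrow> word_map l' = word_map (ls @ [s]) \<Longrightarrow> length k \<le> length l'"
    by blast
  show ?thesis
  proof (cases "length l \<le> length k")
    case True
    have "0 \<le> word_map l (simple_root s) x" for x
      using l(1) assms(2)
    proof (rule root_nonneg_if_not_shortened)
      fix l' assume "l' \<in> lists S" "word_map l' = word_map (l @ [s])"
      then show "length l \<le> length l'"
        using k(3)[of l'] l(2) True by (simp add: word_map_append)
    qed
    then show ?thesis by (simp add: l(2))
  next
    case False
    have "0 \<le> word_map k (simple_root s) x" for x
      using k(1) assms(2)
    proof (rule root_nonneg_if_not_shortened)
      fix l' assume l': "l' \<in> lists S" "word_map l' = word_map (k @ [s])"
      then have "word_map l' = word_map ls" using k(2) assms(2)
        by (simp add: word_map_append fun_eq_iff)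
      then show "length k \<le> length l'"
        using l(3)[of l'] l'(1) False by simp
    qed
    moreover have "word_map k (simple_root s) = (\<lambda>x. - word_map ls (simple_root s) x)"
      using assms(2) by (simp add: k(2) reflection_own_root word_map_uminus)
    ultimately show ?thesis by simp
  qed
qed

end

context finite_coxeter_matrix
begin

lemma word_map_inj: "ls \<in> lists S \<Longrightarrow> word_map ls v = word_map ls w \<longleftrightarrow> v = w"
  by (metis word_map_rev)

lemma word_map_zero: "word_map ls (\<lambda>x. 0) = (\<lambda>x. 0)"
  using word_map_scale[of ls 0 "\<lambda>x. 0"] by simp

lemma simple_root_inj: "simple_root x = simple_root y \<longleftrightarrow> x = y"
  by (auto simp: simple_root_def fun_eq_iff split: if_splits)

text \<open>
  Roots have norm one, so a root on the ray of a simple root is that simple root.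
\<close>

lemma root_scalar_simple_root:
  assumes "ls \<in> lists S" "x \<in> S" "s \<in> S"
    and eq: "word_map ls (simple_root x) = (\<lambda>y. c * simple_root s y)" and "0 \<le> c"
  shows "word_map ls (simple_root x) = simple_root s"
proof -
  have "form (\<lambda>y. c * simple_root s y) (\<lambda>y. c * simple_root s y) = c * c * form (simple_root s) (simple_root s)"
    using form_diff_left[of "\<lambda>_. 0" "- c" "simple_root s"] form_diff_right[of _ "\<lambda>_. 0" "- c" "simple_root s"]
    by (simp add: form_def pair_root_def)
  moreover have "form (simple_root r) (simple_root r) = 1" if "r \<in> S" for r
    using that by (simp add: form_simple_root pair_root_simple_root gram_refl)
  ultimately have "c * c = 1"
    using word_map_form[OF assms(1), of "simple_root x" "simple_root x"] assms(2,3) by (simp add: eq)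
  with \<open>0 \<le> c\<close> have "c = 1"
    by (metis abs_of_nonneg abs_square_eq_1 power2_eq_square)
  with eq show ?thesis by simp
qed

section \<open>Dominant states\<close>

text \<open>
  A dominant state for \<open>X\<close> is the inverse of the shortest representative of a coset \<open>W\<^sub>X w\<close> of
  the reflection group. Minimality is expressed by the signs of the images of the
  simple roots of \<open>X\<close>.
\<close>

definition dominant_states :: "'a set \<Rightarrow> (('a \<Rightarrow> real) \<Rightarrow> 'a \<Rightarrow> real) set" where
  "dominant_states X = {v \<in> word_map ` lists S. \<forall>x\<in>X. \<forall>y. 0 \<le> v (simple_root x) y}"

lemma dominant_state_id: "id \<in> dominant_states X"
  by (auto simp: dominant_states_def simple_root_def intro!: image_eqI[of _ _ "[]"])

lemma dominant_stateE:
  assumes "v \<in> dominant_states X"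
  obtains ls where "ls \<in> lists S" "v = word_map ls"
  using assms by (auto simp: dominant_states_def)

lemma dominant_state_nonneg: "v \<in> dominant_states X \<Longrightarrow> x \<in> X \<Longrightarrow> 0 \<le> v (simple_root x) y"
  by (simp add: dominant_states_def)

lemma dominant_state_inj:
  "v \<in> dominant_states X \<Longrightarrow> v (simple_root x) = v (simple_root y) \<longleftrightarrow> x = y"
  by (elim dominant_stateE) (simp add: word_map_inj simple_root_inj)

text \<open>
  The reflection of \<open>s\<close> changes only the coordinate at \<open>s\<close>. A nonnegative root other than the
  simple root of \<open>s\<close> has a second positive coordinate, so its image cannot be nonpositive.
\<close>

lemma dominant_state_move:
  assumes v: "v \<in> dominant_states X" and X: "X \<subseteq> S" and s: "s \<in> S"
    and no: "\<And>x. x \<in> X \<Longrightarrow> v (simple_root x) \<noteq> simple_root s"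
  shows "reflection s \<circ> v \<in> dominant_states X"
proof -
  obtain ls where ls: "ls \<in> lists S" "v = word_map ls" using v by (rule dominant_stateE)
  have sls: "s # ls \<in> lists S" "reflection s \<circ> v = word_map (s # ls)" using ls s by auto
  have "\<forall>y. 0 \<le> reflection s (v (simple_root x)) y" if x: "x \<in> X" for x
  proof (rule ccontr)
    assume "\<not> ?thesis"
    with root_nonneg_or_nonpos[OF sls(1), of x] x X
    have np: "reflection s (v (simple_root x)) y \<le> 0" for y
      by (auto simp: ls(2))
    have "v (simple_root x) y = 0" if "y \<noteq> s" for y
      using np[of y] dominant_state_nonneg[OF v x, of y] that
      by (simp add: reflection_def simple_root_def)
    then have "v (simple_root x) = (\<lambda>y. v (simple_root x) s * simple_root s y)"
      by (auto simp: simple_root_def)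
    from root_scalar_simple_root[OF ls(1) _ s, of x, folded ls(2), OF _ this] dominant_state_nonneg[OF v x] X x
    have "v (simple_root x) = simple_root s" by blast
    with no x show False by blast
  qed
  moreover have "reflection s \<circ> v \<in> word_map ` lists S"
    unfolding sls(2) using sls(1) by (rule imageI)
  ultimately show ?thesis by (simp add: dominant_states_def)
qed

definition in_plane :: "'a \<Rightarrow> 'a \<Rightarrow> ('a \<Rightarrow> real) \<Rightarrow> bool" where
  "in_plane a b w \<longleftrightarrow> (\<exists>c d. w = (\<lambda>y. c * simple_root a y + d * simple_root b y))"

lemma in_plane_commute: "in_plane a b w \<longleftrightarrow> in_plane b a w"
proof -
  have "in_plane b a w" if pl: "in_plane a b w" for a b
  proof -
    from pl obtain c d where "w = (\<lambda>y. c * simple_root a y + d * simple_root b y)"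
      unfolding in_plane_def by blast
    then have "w = (\<lambda>y. d * simple_root b y + c * simple_root a y)" by (simp add: add.commute)
    then show ?thesis unfolding in_plane_def by blast
  qed
  then show ?thesis by blast
qed

lemma in_plane_diff: "in_plane a b v \<Longrightarrow> in_plane a b w \<Longrightarrow> in_plane a b (\<lambda>y. v y - c * w y)"
proof -
  assume "in_plane a b v" "in_plane a b w"
  then obtain e f g h where "v = (\<lambda>y. e * simple_root a y + f * simple_root b y)"
    "w = (\<lambda>y. g * simple_root a y + h * simple_root b y)" unfolding in_plane_def by blast
  then have "(\<lambda>y. v y - c * w y) = (\<lambda>y. (e - c * g) * simple_root a y + (f - c * h) * simple_root b y)"
    by (auto simp: algebra_simps)
  then show ?thesis unfolding in_plane_def by blast
qed

text \<open>
  The two images span the plane, so the simple root of \<open>a\<close> is a combination of them. The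
  preimage of that simple root under \<open>v\<close> is a root, so the two coefficients have the same sign.
  By nonnegativity of the images in the coordinate at \<open>b\<close>, one of the images must be a multiple
  of the simple root of \<open>a\<close>.
\<close>

lemma plane_simple_root_attained:
  assumes v: "v \<in> dominant_states X" and X: "X \<subseteq> S" "x \<in> X" "y \<in> X" "x \<noteq> y"
    and ab: "a \<in> S" "b \<in> S" "a \<noteq> b"
    and pl: "in_plane a b (v (simple_root x))" "in_plane a b (v (simple_root y))"
  shows "v (simple_root x) = simple_root a \<or> v (simple_root y) = simple_root a"
proof -
  obtain ls where ls: "ls \<in> lists S" "v = word_map ls" using v by (rule dominant_stateE)
  obtain c1 d1 where x: "v (simple_root x) = (\<lambda>z. c1 * simple_root a z + d1 * simple_root b z)"
    using pl(1) unfolding in_plane_def by blast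
  obtain c2 d2 where y: "v (simple_root y) = (\<lambda>z. c2 * simple_root a z + d2 * simple_root b z)"
    using pl(2) unfolding in_plane_def by blast
  have nn: "0 \<le> c1" "0 \<le> d1" "0 \<le> c2" "0 \<le> d2"
    using dominant_state_nonneg[OF v X(2), of a, unfolded x]
      dominant_state_nonneg[OF v X(2), of b, unfolded x]
      dominant_state_nonneg[OF v X(3), of a, unfolded y]
      dominant_state_nonneg[OF v X(3), of b, unfolded y] ab
    by (simp_all add: simple_root_def)
  (* Coordinates of images of vectors in the span of the simple roots of x and y. *)
  have lin: "v (\<lambda>z. e * simple_root x z + f * simple_root y z) =
      (\<lambda>z. (e * c1 + f * c2) * simple_root a z + (e * d1 + f * d2) * simple_root b z)" for e f
    using x y unfolding ls(2) by (simp add: word_map_linear algebra_simps)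
  have zero: "e = 0 \<and> f = 0" if "e * c1 + f * c2 = 0" "e * d1 + f * d2 = 0" for e f
  proof -
    have "v (\<lambda>z. e * simple_root x z + f * simple_root y z) = v (\<lambda>z. 0)"
      unfolding lin that by (simp add: ls(2) word_map_zero)
    then have *: "(\<lambda>z. e * simple_root x z + f * simple_root y z) = (\<lambda>z. 0)"
      using word_map_inj[OF ls(1)] ls(2) by simp
    from fun_cong[OF *, of x] fun_cong[OF *, of y] X(4) show ?thesis
      by (simp add: simple_root_def)
  qed
  (* Cramer's rule for the simple root of a in terms of the two images. *)
  define D where "D = c1 * d2 - c2 * d1"
  have "D \<noteq> 0"
  proof
    assume "D = 0"
    then have "d2 = 0 \<and> - d1 = 0" "- c2 = 0 \<and> c1 = 0"
      by (intro zero; simp add: D_def algebra_simps)+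
    then show False using zero[of 1 0] by simp
  qed
  have "v (\<lambda>z. (d2 / D) * simple_root x z + (- d1 / D) * simple_root y z) = simple_root a"
  proof -
    have "d2 / D * c1 + - d1 / D * c2 = 1" "d2 / D * d1 + - d1 / D * d2 = 0"
      using \<open>D \<noteq> 0\<close> by (simp_all add: field_simps) (simp add: D_def)
    then show ?thesis unfolding lin by simp
  qed
  then have inv: "word_map (rev ls) (simple_root a) =
      (\<lambda>z. (d2 / D) * simple_root x z + (- d1 / D) * simple_root y z)"
    using word_map_rev[OF ls(1)] ls(2) by metis
  have "(\<forall>z. 0 \<le> (d2 / D) * simple_root x z + (- d1 / D) * simple_root y z) \<or>
      (\<forall>z. (d2 / D) * simple_root x z + (- d1 / D) * simple_root y z \<le> 0)"
    using root_nonneg_or_nonpos[of "rev ls" a] ls(1) ab(1) unfolding inv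
    by (simp add: in_lists_conv_set)
  then have "0 \<le> d2 / D \<and> 0 \<le> - d1 / D \<or> d2 / D \<le> 0 \<and> - d1 / D \<le> 0"
  proof (elim disjE)
    assume *: "\<forall>z. 0 \<le> (d2 / D) * simple_root x z + (- d1 / D) * simple_root y z"
    from *[rule_format, of x] *[rule_format, of y] X(4) show ?thesis by (simp add: simple_root_def)
  next
    assume *: "\<forall>z. (d2 / D) * simple_root x z + (- d1 / D) * simple_root y z \<le> 0"
    from *[rule_format, of x] *[rule_format, of y] X(4) show ?thesis by (simp add: simple_root_def)
  qed
  then have "0 \<le> (d2 / D) * (- d1 / D)"
    unfolding zero_le_mult_iff by blast
  then have "d1 * d2 \<le> 0"
    using \<open>D \<noteq> 0\<close> by (auto simp: field_simps divide_le_0_iff zero_le_divide_iff mult_le_0_iff)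
  then consider "d1 = 0" | "d2 = 0" using nn by (auto simp: mult_le_0_iff)
  then show ?thesis
  proof cases
    case 1
    then show ?thesis using root_scalar_simple_root[of ls x a c1] ls ab(1) X nn x by auto
  next
    case 2
    then show ?thesis using root_scalar_simple_root[of ls y a c2] ls ab(1) X nn y by auto
  qed
qed

text \<open>
  Within the plane of two vertices a dominant state therefore has no intermediate behaviour:
  it sends at most one simple root of \<open>X\<close> into the plane, or it identifies two vertices of \<open>X\<close>
  with the two given ones.
\<close>

lemma plane_two_roots:
  assumes v: "v \<in> dominant_states X" and X: "X \<subseteq> S" "x \<in> X" "y \<in> X" "x \<noteq> y"
    and ab: "a \<in> S" "b \<in> S" "a \<noteq> b"
    and pl: "in_plane a b (v (simple_root x))" "in_plane a b (v (simple_root y))"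
  shows "\<exists>x'\<in>X. \<exists>y'\<in>X. x' \<noteq> y' \<and> v (simple_root x') = simple_root a \<and> v (simple_root y') = simple_root b"
  using plane_simple_root_attained[OF assms] plane_simple_root_attained[OF v X ab(2,1)] pl ab(3) X(2-4)
    in_plane_commute simple_root_inj by metis

text \<open>
  The form is invariant, and \<open>cos (\<pi> / m)\<close> determines \<open>m\<close>.
\<close>

lemma label_of_roots:
  assumes v: "v \<in> dominant_states X" and X: "X \<subseteq> S" "x \<in> X" "y \<in> X"
    and ab: "a \<in> S" "b \<in> S"
    and eq: "v (simple_root x) = simple_root a" "v (simple_root y) = simple_root b"
  shows "m x y = m a b"
proof -
  obtain ls where ls: "ls \<in> lists S" "v = word_map ls" using v by (rule dominant_stateE)
  have S: "x \<in> S" "y \<in> S" using X by auto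
  have pos: "1 \<le> m r s" if "r \<in> S" "s \<in> S" for r s
    using that label_refl[of r] label_ge_2[of r s] by (cases "r = s") auto
  have "gram a b = gram x y"
    using word_map_form[OF ls(1), of "simple_root x" "simple_root y"] eq ls(2) S ab
    by (simp add: form_simple_root pair_root_simple_root)
  then show ?thesis
    using cos_pi_over_inj[OF pos[OF S] pos[OF ab]] by (simp add: gram_def)
qed

end

section \<open>Actions of presented groups\<close>

lemma fold_group_word_closed:
  fixes act :: "'a \<times> bool \<Rightarrow> 'b \<Rightarrow> 'b"
  assumes closed: "\<And>x e p. x \<in> X \<Longrightarrow> p \<in> \<Omega> \<Longrightarrow> act (x, e) p \<in> \<Omega>"
    and "w \<in> group_words X" "p \<in> \<Omega>"
  shows "fold act w p \<in> \<Omega>"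
  using assms(2,3) by (induction w arbitrary: p) (auto simp: closed)

text \<open>
  Letters act on the right, so a word is read from left to right by \<open>fold\<close>.
\<close>

lemma presented_group_action:
  fixes act :: "'a \<times> bool \<Rightarrow> 'b \<Rightarrow> 'b"
  assumes closed: "\<And>x e p. x \<in> X \<Longrightarrow> p \<in> \<Omega> \<Longrightarrow> act (x, e) p \<in> \<Omega>"
    and cancel: "\<And>x e p. x \<in> X \<Longrightarrow> p \<in> \<Omega> \<Longrightarrow> act (x, \<not> e) (act (x, e) p) = p"
    and relation: "\<And>l r p. (l, r) \<in> R \<Longrightarrow> l \<in> group_words X \<Longrightarrow> r \<in> group_words X \<Longrightarrow>
      p \<in> \<Omega> \<Longrightarrow> fold act l p = fold act r p"
    and "(u, v) \<in> presentation_cong X R" "p \<in> \<Omega>"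
  shows "fold act u p = fold act v p"
  using assms(4,5)
  by (induction arbitrary: p rule: presentation_cong.induct)
    (auto simp: cancel relation fold_group_word_closed[where act = act, OF closed])

section \<open>The Artin-Tits group and its parabolic subgroups\<close>

locale artin_tits = group A for A :: "'a group_word set monoid" (structure) +
  fixes S :: "'a set" and M :: "'a \<Rightarrow> 'a \<Rightarrow> enat"
  assumes A_eq: "A = artin_group S M" and coxeter_matrix: "coxeter_matrix S M"
begin

definition val :: "'a group_word \<Rightarrow> 'a group_word set" where
  "val u = presentation_cong S (artin_relations S M) `` {u}"

lemma val_eq_iff:
  "u \<in> group_words S \<Longrightarrow> v \<in> group_words S \<Longrightarrow>
    val u = val v \<longleftrightarrow> (u, v) \<in> presentation_cong S (artin_relations S M)"
  unfolding val_def by (rule eq_equiv_class_iff[OF equiv_presentation_cong])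

lemma carrier_eq: "carrier A = val ` group_words S"
  by (auto simp: A_eq artin_group_def presented_group_def quotient_def val_def)

lemma val_closed [simp, intro]: "u \<in> group_words S \<Longrightarrow> val u \<in> carrier A"
  by (simp add: carrier_eq)

lemma val_Nil [simp]: "val [] = \<one>"
  by (simp add: A_eq artin_group_def presented_group_def val_def)

lemma val_append:
  "u \<in> group_words S \<Longrightarrow> v \<in> group_words S \<Longrightarrow> val (u @ v) = val u \<otimes> val v"
  by (simp add: A_eq artin_group_def val_def presented_group_mult_class)

lemma group_words_mono: "X \<subseteq> Y \<Longrightarrow> group_words X \<subseteq> group_words Y"
  unfolding group_words_def by (intro lists_mono) auto

lemma val_Cons: "x \<in> S \<Longrightarrow> u \<in> group_words S \<Longrightarrow> val ((x, e) # u) = val [(x, e)] \<otimes> val u"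
  using val_append[of "[(x, e)]" u] by simp

lemma val_cancel: "x \<in> S \<Longrightarrow> val [(x, e)] \<otimes> val [(x, \<not> e)] = \<one>"
  using presentation_cong.cancel[of "[]" S "[]" x e "artin_relations S M"]
  by (simp add: val_append[symmetric] val_eq_iff flip: val_Nil)

lemma val_alternating:
  assumes "s \<in> S" "t \<in> S" "s \<noteq> t" "M s t = enat k"
  shows "val (alternating_word (s, True) (t, True) k) = val (alternating_word (t, True) (s, True) k)"
proof -
  have w: "alternating_word (s, e) (t, e) n \<in> group_words S" if "s \<in> S" "t \<in> S" for s t e n
    using that by (induction n arbitrary: s t) auto
  have "(alternating_word (s, True) (t, True) k, alternating_word (t, True) (s, True) k)
      \<in> artin_relations S M"
    using assms unfolding artin_relations_def by blast
  from presentation_cong.relation[OF _ _ this, of "[]" S "[]"] w assms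
  show ?thesis by (simp add: val_eq_iff)
qed

definition parabolic :: "'a set \<Rightarrow> 'a group_word set set" where
  "parabolic X = val ` group_words X"

lemma parabolic_mono: "X \<subseteq> Y \<Longrightarrow> parabolic X \<subseteq> parabolic Y"
  unfolding parabolic_def by (intro image_mono group_words_mono)

lemma inverse_words: "u \<in> group_words X \<Longrightarrow> rev (map (apsnd Not) u) \<in> group_words X"
  by (induction u) auto

lemma subgroup_parabolic:
  assumes X: "X \<subseteq> S"
  shows "subgroup (parabolic X) A"
proof (rule subgroupI)
  have w: "u \<in> group_words S" if "u \<in> group_words X" for u
    using that group_words_mono[OF X] by blast
  show "parabolic X \<subseteq> carrier A"
    using w by (auto simp: parabolic_def)
  have "[] \<in> group_words X" by simp
  then show "parabolic X \<noteq> {}" unfolding parabolic_def by blast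
  show "inv a \<in> parabolic X" if "a \<in> parabolic X" for a
  proof -
    from that obtain u where u: "u \<in> group_words X" "a = val u" unfolding parabolic_def by blast
    let ?u = "rev (map (apsnd Not) u)"
    have "val ?u \<otimes> val u = \<one>"
      using presentation_cong_inverse[OF w[OF u(1)], of "artin_relations S M"]
        w[OF u(1)] w[OF inverse_words[OF u(1)]]
      by (simp add: val_append[symmetric] val_eq_iff flip: val_Nil)
    then have "inv (val u) = val ?u"
      using w[OF u(1)] w[OF inverse_words[OF u(1)]] by (intro inv_equality) auto
    then show ?thesis using inverse_words[OF u(1)] by (simp add: u parabolic_def)
  qed
  show "a \<otimes> b \<in> parabolic X" if "a \<in> parabolic X" "b \<in> parabolic X" for a b
    using that w unfolding parabolic_def
    by (auto simp: val_append[symmetric] intro!: imageI)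
qed

lemma finite_vertices: "finite S"
  using coxeter_matrix by (simp add: coxeter_matrix_def)

text \<open>
  Infinite labels are replaced by a number that exceeds all finite ones, so that equality of
  the new labels still detects equality with a finite label of \<open>M\<close>.
\<close>

definition big_label :: nat where
  "big_label = 3 + (\<Sum>s\<in>S. \<Sum>t\<in>S. the_enat (M s t))"

definition finite_label :: "'a \<Rightarrow> 'a \<Rightarrow> nat" where
  "finite_label s t = (case M s t of enat k \<Rightarrow> k | \<infinity> \<Rightarrow> big_label)"

lemma label_less_big_label:
  assumes "s \<in> S" "t \<in> S" "M s t = enat k"
  shows "k < big_label"
proof -
  have "k \<le> (\<Sum>t\<in>S. the_enat (M s t))"
    using member_le_sum[OF assms(2), of "\<lambda>t. the_enat (M s t)"] assms(3) finite_vertices by simp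
  also have "\<dots> \<le> (\<Sum>s\<in>S. \<Sum>t\<in>S. the_enat (M s t))"
    using member_le_sum[OF assms(1), of "\<lambda>s. \<Sum>t\<in>S. the_enat (M s t)"] finite_vertices by simp
  finally show ?thesis by (simp add: big_label_def)
qed

lemma finite_label_enat: "M s t = enat k \<Longrightarrow> finite_label s t = k"
  by (simp add: finite_label_def)

lemma enat_finite_label:
  assumes "x \<in> S" "y \<in> S" "s \<in> S" "t \<in> S" "finite_label x y = finite_label s t" "M s t = enat k"
  shows "M x y = enat k"
  using assms label_less_big_label[of s t k] by (auto simp: finite_label_def split: enat.splits)

sublocale finite_coxeter_matrix S finite_label
proof
  show "finite S" by (rule finite_vertices)
  show "finite_label s s = 1" if "s \<in> S" for s
    using that coxeter_matrix by (simp add: coxeter_matrix_def finite_label_def one_enat_def)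
  show "finite_label s t = finite_label t s" if "s \<in> S" "t \<in> S" for s t
    using that coxeter_matrix by (cases "s = t") (auto simp: coxeter_matrix_def finite_label_def)
  show "2 \<le> finite_label s t" if "s \<in> S" "t \<in> S" "s \<noteq> t" for s t
  proof -
    have "2 \<le> M s t" using that coxeter_matrix by (auto simp: coxeter_matrix_def)
    then show ?thesis
      by (auto simp: finite_label_def big_label_def numeral_eq_enat split: enat.splits)
  qed
qed

section \<open>A set-theoretic retraction onto a parabolic subgroup\<close>

text \<open>
  Read a word from left to right and keep track of a dominant state \<open>v\<close>, that is, of a coset
  of \<open>W\<^sub>X\<close>, together with the group element \<open>g\<close> recorded so far. If the letter \<open>s\<close> moves
  the coset, only \<open>v\<close> changes. If it fixes the coset, then it is conjugate, through the minimal
  representative, to a unique generator \<open>x\<close> in \<open>X\<close>, and that generator is appended to \<open>g\<close> with the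
  same exponent. The outcome depends only on the group element: this is an action of the
  Artin-Tits group, and started at \<open>(id, \<one>)\<close> it retracts the group onto the parabolic subgroup.
  In general the retraction is only a map of sets and not a homomorphism.
\<close>

fun retraction_step :: "'a set \<Rightarrow> 'a \<times> bool \<Rightarrow> (('a \<Rightarrow> real) \<Rightarrow> 'a \<Rightarrow> real) \<times> 'a group_word set \<Rightarrow>
    (('a \<Rightarrow> real) \<Rightarrow> 'a \<Rightarrow> real) \<times> 'a group_word set" where
  "retraction_step X (s, e) (v, g) =
     (if \<exists>x\<in>X. v (simple_root x) = simple_root s
      then (v, g \<otimes> val [(THE x. x \<in> X \<and> v (simple_root x) = simple_root s, e)])
      else (reflection s \<circ> v, g))"

declare retraction_step.simps [simp del]

lemma retraction_step_emit:
  assumes "v \<in> dominant_states X" "x \<in> X" "v (simple_root x) = simple_root s"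
  shows "retraction_step X (s, e) (v, g) = (v, g \<otimes> val [(x, e)])"
proof -
  have "(THE x. x \<in> X \<and> v (simple_root x) = simple_root s) = x"
    using assms dominant_state_inj[OF assms(1)] by (intro the_equality) (auto, metis)
  with assms show ?thesis by (auto simp: retraction_step.simps)
qed

lemma retraction_step_move:
  assumes "\<And>x. x \<in> X \<Longrightarrow> v (simple_root x) \<noteq> simple_root s"
  shows "retraction_step X (s, e) (v, g) = (reflection s \<circ> v, g)"
  using assms by (auto simp: retraction_step.simps)

lemma retraction_step_closed:
  assumes X: "X \<subseteq> S" "s \<in> S" and p: "p \<in> dominant_states X \<times> carrier A"
  shows "retraction_step X (s, e) p \<in> dominant_states X \<times> carrier A"
proof -
  obtain v g where vg: "p = (v, g)" "v \<in> dominant_states X" "g \<in> carrier A" using p by auto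
  show ?thesis
  proof (cases "\<exists>x\<in>X. v (simple_root x) = simple_root s")
    case True
    then obtain x where x: "x \<in> X" "v (simple_root x) = simple_root s" by blast
    with vg X(1) show ?thesis by (auto simp: retraction_step_emit)
  next
    case False
    with vg show ?thesis
      using dominant_state_move[OF vg(2) X] by (simp add: retraction_step_move)
  qed
qed

lemma retraction_fold_closed:
  assumes X: "X \<subseteq> S" and "w \<in> group_words S" "p \<in> dominant_states X \<times> carrier A"
  shows "fold (retraction_step X) w p \<in> dominant_states X \<times> carrier A"
  using retraction_step_closed[OF X] assms(2,3) by (rule fold_group_word_closed)

lemma retraction_step_cancel:
  assumes X: "X \<subseteq> S" "s \<in> S" and p: "p \<in> dominant_states X \<times> carrier A"
  shows "retraction_step X (s, \<not> e) (retraction_step X (s, e) p) = p"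
proof -
  obtain v g where vg: "p = (v, g)" "v \<in> dominant_states X" "g \<in> carrier A" using p by auto
  show ?thesis
  proof (cases "\<exists>x\<in>X. v (simple_root x) = simple_root s")
    case True
    then obtain x where x: "x \<in> X" "v (simple_root x) = simple_root s" by blast
    have "x \<in> S" using x X by auto
    then show ?thesis
      using vg val_cancel[of x e] by (simp add: retraction_step_emit[OF vg(2) x] m_assoc)
  next
    case False
    have "reflection s (v (simple_root x)) \<noteq> simple_root s" if x: "x \<in> X" for x
    proof
      assume "reflection s (v (simple_root x)) = simple_root s"
      then have "v (simple_root x) = (\<lambda>y. - simple_root s y)"
        using reflection_involutive[OF X(2)] reflection_own_root[OF X(2)] by metis
      with dominant_state_nonneg[OF vg(2) x, of s] show False by (simp add: simple_root_def)
    qed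
    then have "retraction_step X (s, \<not> e) (reflection s \<circ> v, g) = (reflection s \<circ> (reflection s \<circ> v), g)"
      by (intro retraction_step_move) auto
    with False vg X(2) show ?thesis
      by (simp add: retraction_step_move fun_eq_iff)
  qed
qed

text \<open>
  The first case of the braid relation: \<open>v\<close> identifies \<open>{x, y}\<close> with \<open>{a, b}\<close>, no letter moves the
  state, and the alternating word is copied.
\<close>

lemma retraction_braid_full:
  assumes v: "v \<in> dominant_states X" and X: "X \<subseteq> S" "x \<in> X" "y \<in> X" and g: "g \<in> carrier A"
    and eq: "v (simple_root x) = simple_root a" "v (simple_root y) = simple_root b"
  shows "fold (retraction_step X) (alternating_word (a, True) (b, True) k) (v, g) =
    (v, g \<otimes> val (alternating_word (x, True) (y, True) k))"
proof -
  have w: "alternating_word (s, True) (t, True) n \<in> group_words S" if "s \<in> S" "t \<in> S" for s t n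
    using that by (induction n arbitrary: s t) auto
  from X g eq show ?thesis
  proof (induction k arbitrary: a b x y g)
    case (Suc k)
    have S: "x \<in> S" "y \<in> S" using Suc.prems by auto
    from Suc.prems S have "fold (retraction_step X) (alternating_word (a, True) (b, True) (Suc k)) (v, g) =
      (v, (g \<otimes> val [(x, True)]) \<otimes> val (alternating_word (y, True) (x, True) k))"
      by (simp add: retraction_step_emit[OF v] Suc.IH[of y x])
    also have "\<dots> = (v, g \<otimes> val (alternating_word (x, True) (y, True) (Suc k)))"
      using S Suc.prems by (simp add: m_assoc w val_Cons[of x "alternating_word _ _ _"])
    finally show ?case .
  qed simp
qed

text \<open>
  The second case: no element of \<open>X\<close> other than \<open>x\<close> has its simple root sent into the plane
  of \<open>a\<close> and \<open>b\<close>. The word then emits \<open>x\<close> exactly when it meets the root \<open>v (simple_root x)\<close>, and each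
  emission multiplies the group element underlying the state by the reflection of \<open>x\<close>. The result
  involves only the number of times that the root is met. For \<open>k = finite_label a b\<close> this number does not
  change when \<open>a\<close> and \<open>b\<close> are exchanged, as both words meet the same roots in opposite order.
\<close>

lemma retraction_braid_single:
  fixes v X x a b
  defines "rt \<equiv> \<lambda>i y. chebyshev_sine (finite_label a b) (Suc i) * simple_root a y +
      chebyshev_sine (finite_label a b) i * simple_root b y"
  defines "n \<equiv> \<lambda>k. \<Sum>i<k. of_bool (x \<in> X \<and> v (simple_root x) = rt i) :: nat"
  assumes v: "v \<in> dominant_states X" and X: "X \<subseteq> S" and x: "x \<in> S" and g: "g \<in> carrier A"
    and ab: "a \<in> S" "b \<in> S" "a \<noteq> b"
    and single: "\<And>y. y \<in> X \<Longrightarrow> in_plane a b (v (simple_root y)) \<Longrightarrow> y = x"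
    and k: "k \<le> finite_label a b"
  shows "fold (retraction_step X) (alternating_word (a, True) (b, True) k) (v, g) =
    (word_map (rev (alternating_word a b k)) \<circ> v \<circ> (if even (n k) then id else reflection x),
     g \<otimes> val [(x, True)] [^] n k)"
  using k
proof (induction k)
  case 0
  then show ?case using g by (simp add: n_def)
next
  case (Suc k)
  define p where "p = fold (retraction_step X) (alternating_word (a, True) (b, True) k) (v, g)"
  define d where "d = alternating_word a b k"
  define v' where "v' = word_map (rev d) \<circ> v \<circ> (if even (n k) then id else reflection x)"
  define h where "h = g \<otimes> val [(x, True)] [^] n k"
  define c where "c = (if even k then a else b)"
  have p_eq: "p = (v', h)"
    using Suc.IH[OF Suc_leD[OF Suc.prems]] unfolding p_def v'_def h_def d_def .
  have cS: "c \<in> S" using ab by (simp add: c_def)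
  have dS: "d \<in> lists S" using set_alternating_word[of a b k] ab by (auto simp: d_def in_lists_conv_set)
  obtain ls where ls: "ls \<in> lists S" "v = word_map ls" using v by (rule dominant_stateE)
  have "p \<in> dominant_states X \<times> carrier A"
  proof -
    have "alternating_word (a, True) (b, True) k \<in> group_words S"
      using set_alternating_word[of "(a, True)" "(b, True)" k] ab by (auto simp: group_words_def in_lists_conv_set)
    with v g show ?thesis unfolding p_def by (intro retraction_fold_closed[OF X]) auto
  qed
  then have v': "v' \<in> dominant_states X" by (simp add: p_eq)
  have word: "alternating_word (a, True) (b, True) (Suc k) = alternating_word (a, True) (b, True) k @ [(c, True)]"
    "alternating_word a b (Suc k) = d @ [c]"
    unfolding alternating_word_snoc by (auto simp: c_def d_def)
  have lhs: "fold (retraction_step X) (alternating_word (a, True) (b, True) (Suc k)) (v, g) =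
      retraction_step X (c, True) (v', h)"
    unfolding word p_eq[symmetric] p_def by simp
  have root: "word_map d (simple_root c) = rt k"
    using alternating_root[OF ab, of k] by (simp add: d_def c_def rt_def)
  have rt_nonneg: "0 \<le> rt k y" for y
    using Suc.prems label_ge_2[OF ab] unfolding rt_def
    by (intro add_nonneg_nonneg mult_nonneg_nonneg chebyshev_sine_nonneg) (auto simp: simple_root_def)
  have rt_plane: "in_plane a b (rt k)" unfolding rt_def in_plane_def by blast
  have rt_nonzero: "rt k \<noteq> (\<lambda>y. 0)"
  proof
    assume "rt k = (\<lambda>y. 0)"
    then have "word_map d (simple_root c) = word_map d (\<lambda>y. 0)" by (simp add: root word_map_zero)
    then have "simple_root c = (\<lambda>y. 0)" using word_map_inj[OF dS] by blast
    from fun_cong[OF this, of c] show False by (simp add: simple_root_def)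
  qed
  have emit_iff: "v' (simple_root y) = simple_root c \<longleftrightarrow>
      v ((if even (n k) then id else reflection x) (simple_root y)) = rt k" for y
  proof -
    have "v' (simple_root y) = simple_root c \<longleftrightarrow>
       word_map d (v' (simple_root y)) = word_map d (simple_root c)"
      using word_map_inj[OF dS] by blast
    then show ?thesis by (simp add: v'_def root word_map_rev'[OF dS])
  qed
  (* rt k is the root met by the letter number k, counted from 0. *)
  show ?case
  proof (cases "x \<in> X \<and> v (simple_root x) = rt k")
    case True
    have "even (n k)"
    proof (rule ccontr)
      assume odd: "\<not> even (n k)"
      have "v' (simple_root x) = (\<lambda>y. - simple_root c y)"
        using True odd x unfolding v'_def
        by (simp add: reflection_own_root ls(2) word_map_uminus flip: root)
          (simp add: word_map_rev[OF dS])
      with dominant_state_nonneg[OF v', of x c] True show False by (simp add: simple_root_def)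
    qed
    with True have "v' (simple_root x) = simple_root c" by (simp add: emit_iff)
    then have "retraction_step X (c, True) (v', h) = (v', h \<otimes> val [(x, True)])"
      using retraction_step_emit[OF v'] True by blast
    moreover have "n (Suc k) = Suc (n k)" using True unfolding n_def sum.lessThan_Suc by simp
    (* Transport by v and d turns the reflection of x into that of c, so the two cancel. *)
    moreover have "word_map (rev (d @ [c])) \<circ> v \<circ> reflection x = v'"
    proof -
      have "reflection c (word_map (rev d) (v (reflection x w))) = word_map (rev d) (v w)" for w
      proof -
        have "pair_root x w = form (simple_root x) w" using x by (simp add: form_simple_root)
        also have "\<dots> = form (v (simple_root x)) (v w)" using word_map_form[OF ls(1)] ls(2) by simp
        also have "\<dots> = form (word_map d (simple_root c)) (word_map d (word_map (rev d) (v w)))"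
          using True by (simp add: root word_map_rev'[OF dS])
        also have "\<dots> = pair_root c (word_map (rev d) (v w))"
          using word_map_form[OF dS] cS by (simp add: form_simple_root)
        finally have pr: "pair_root x w = \<dots>" .
        have "word_map (rev d) (v (reflection x w)) =
          (\<lambda>y. word_map (rev d) (v w) y - (2 * pair_root x w) * word_map (rev d) (v (simple_root x)) y)"
          unfolding reflection_def[of x w] ls(2) by (simp only: word_map_diff)
        also have "\<dots> = reflection c (word_map (rev d) (v w))"
          using True by (simp add: reflection_def pr word_map_rev[OF dS] flip: root)
        finally show ?thesis using reflection_involutive[OF cS] by simp
      qed
      then show ?thesis using \<open>even (n k)\<close> by (simp add: v'_def fun_eq_iff)
    qed
    moreover have "h \<otimes> val [(x, True)] = g \<otimes> val [(x, True)] [^] Suc (n k)"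
      using g x by (simp add: h_def m_assoc)
    ultimately show ?thesis
      unfolding lhs using \<open>even (n k)\<close> by (simp only: word(2) even_Suc if_False not_True_eq_False)
  next
    case False
    then have nk: "n (Suc k) = n k" unfolding n_def sum.lessThan_Suc by auto
    have "v' (simple_root y) \<noteq> simple_root c" if y: "y \<in> X" for y
    proof
      assume "v' (simple_root y) = simple_root c"
      then have eq: "v ((if even (n k) then id else reflection x) (simple_root y)) = rt k"
        by (simp add: emit_iff)
      show False
      proof (cases "even (n k)")
        case True
        then have "v (simple_root y) = rt k" using eq by simp
        with single[OF y] rt_plane False y show False by auto
      next
        case odd: False
        then have "n k \<noteq> 0" by (simp add: odd_pos)
        then obtain i where "x \<in> X" "v (simple_root x) = rt i"
          unfolding n_def by (auto split: if_splits)
        then have xpl: "x \<in> X" "in_plane a b (v (simple_root x))"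
          unfolding rt_def in_plane_def by auto
        have eq': "v (\<lambda>z. simple_root y z - 2 * gram x y * simple_root x z) = rt k"
          using eq odd y X by (auto simp: reflection_simple_root)
        have vy: "v (simple_root y) = (\<lambda>z. rt k z - (- 2 * gram x y) * v (simple_root x) z)"
          unfolding eq'[symmetric] ls(2) word_map_diff by simp
        have "in_plane a b (v (simple_root y))"
          unfolding vy by (rule in_plane_diff[OF rt_plane xpl(2)])
        with single y have [simp]: "y = x" by blast
        have "rt k = (\<lambda>z. - v (simple_root x) z)"
          using eq odd x by (simp add: reflection_own_root ls(2) word_map_uminus)
        then have "rt k z \<le> 0" for z
          using dominant_state_nonneg[OF v xpl(1), of z] by simp
        with rt_nonneg have "rt k = (\<lambda>z. 0)" by (intro ext antisym) auto
        with rt_nonzero show False ..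
      qed
    qed
    then have "retraction_step X (c, True) (v', h) = (reflection c \<circ> v', h)"
      by (rule retraction_step_move)
    then show ?thesis
      unfolding lhs unfolding word(2) nk by (simp add: v'_def h_def fun_eq_iff)
  qed
qed

lemma retraction_relation:
  assumes X: "X \<subseteq> S" and p: "p \<in> dominant_states X \<times> carrier A"
    and st: "s \<in> S" "t \<in> S" "s \<noteq> t" "M s t = enat k"
  shows "fold (retraction_step X) (alternating_word (s, True) (t, True) k) p =
    fold (retraction_step X) (alternating_word (t, True) (s, True) k) p"
proof -
  obtain v g where vg: "p = (v, g)" "v \<in> dominant_states X" "g \<in> carrier A" using p by auto
  have k: "finite_label s t = k" "finite_label t s = k"
    using st finite_label_enat label_sym by auto
  have k2: "2 \<le> k" using label_ge_2[OF st(1-3)] k by simp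
  show ?thesis
  proof (cases "\<exists>x\<in>X. \<exists>y\<in>X. x \<noteq> y \<and> in_plane s t (v (simple_root x)) \<and> in_plane s t (v (simple_root y))")
    case True
    then obtain x y where xy: "x \<in> X" "y \<in> X" "x \<noteq> y"
      "v (simple_root x) = simple_root s" "v (simple_root y) = simple_root t"
      using plane_two_roots[OF vg(2) X _ _ _ st(1-3)] by metis
    have S: "x \<in> S" "y \<in> S" using xy X by auto
    have "M x y = enat k"
      using enat_finite_label[OF S st(1,2) label_of_roots[OF vg(2) X xy(1,2) st(1,2) xy(4,5)] st(4)] .
    then have "val (alternating_word (x, True) (y, True) k) = val (alternating_word (y, True) (x, True) k)"
      using val_alternating S xy(3) by blast
    then show ?thesis
      using retraction_braid_full[OF vg(2) X xy(1,2) vg(3) xy(4,5)]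
        retraction_braid_full[OF vg(2) X xy(2,1) vg(3) xy(5,4)] by (simp add: vg(1))
  next
    case False
    obtain x where x: "x \<in> S" "\<And>y. y \<in> X \<Longrightarrow> in_plane s t (v (simple_root y)) \<Longrightarrow> y = x"
    proof (cases "\<exists>x\<in>X. in_plane s t (v (simple_root x))")
      case True
      then obtain x where "x \<in> X" "in_plane s t (v (simple_root x))" by blast
      with False X show ?thesis by (intro that[of x]) auto
    next
      case False
      (* Nothing is emitted, and any vertex can play the part of x. *)
      then show ?thesis using st(1) by (intro that[of s]) auto
    qed
    have x': "\<And>y. y \<in> X \<Longrightarrow> in_plane t s (v (simple_root y)) \<Longrightarrow> y = x"
      using x(2) in_plane_commute by metis
    define rt where "rt = (\<lambda>s t i y. chebyshev_sine k (Suc i) * simple_root (s :: 'a) y +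
      chebyshev_sine k i * simple_root t y)"
    define n where "n = (\<lambda>s t. \<Sum>i<k. of_bool (x \<in> X \<and> v (simple_root x) = rt s t i) :: nat)"
    (* The two words meet the same roots in opposite order. *)
    have rt: "rt s t (k - Suc i) = rt t s i" if "i < k" for i
    proof -
      have "chebyshev_sine k (Suc (k - Suc i)) = chebyshev_sine k i"
        "chebyshev_sine k (k - Suc i) = chebyshev_sine k (Suc i)"
        using chebyshev_sine_reflect[OF k2, of i] chebyshev_sine_reflect[OF k2, of "Suc i"] that
        by (simp_all add: Suc_diff_Suc)
      then show ?thesis unfolding rt_def by (simp add: add.commute)
    qed
    have n: "n s t = n t s"
    proof -
      have "n s t = (\<Sum>i<k. of_bool (x \<in> X \<and> v (simple_root x) = rt s t (k - Suc i)))"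
        unfolding n_def by (rule sum.nat_diff_reindex[symmetric])
      also have "\<dots> = n t s" unfolding n_def by (intro sum.cong) (auto simp: rt)
      finally show ?thesis .
    qed
    have rev: "word_map (rev (alternating_word s t k)) = word_map (rev (alternating_word t s k))"
      using braid_relation[OF st(1-3)] k by (simp add: rev_alternating_word)
    show ?thesis
      using retraction_braid_single[OF vg(2) X x(1) vg(3) st(1-3) x(2), of k]
        retraction_braid_single[OF vg(2) X x(1) vg(3) st(2,1) st(3)[symmetric] x', of k]
      unfolding k vg(1) using n rev by (simp add: n_def rt_def)
  qed
qed

lemma retraction_cong:
  assumes X: "X \<subseteq> S" and p: "p \<in> dominant_states X \<times> carrier A"
    and u: "u \<in> group_words S" "w \<in> group_words S" "val u = val w"
  shows "fold (retraction_step X) u p = fold (retraction_step X) w p"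
proof (rule presented_group_action[OF _ _ _ _ p])
  show "(u, w) \<in> presentation_cong S (artin_relations S M)"
    using u val_eq_iff by blast
  show "fold (retraction_step X) l p = fold (retraction_step X) r p"
    if "(l, r) \<in> artin_relations S M" "p \<in> dominant_states X \<times> carrier A" for l r p
    using that retraction_relation[OF X that(2)] unfolding artin_relations_def by blast
qed (use retraction_step_closed[OF X] retraction_step_cancel[OF X] in auto)

lemma retraction_fixes:
  assumes X: "X \<subseteq> S" and u: "u \<in> group_words X" and g: "g \<in> carrier A"
  shows "fold (retraction_step X) u (id, g) = (id, g \<otimes> val u)"
  using u g
proof (induction u arbitrary: g)
  case (Cons p u)
  obtain x e where p: "p = (x, e)" by (cases p)
  have "x \<in> X" "u \<in> group_words X" using Cons.prems p by auto
  moreover have "x \<in> S" "u \<in> group_words S" using calculation X group_words_mono[OF X] by auto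
  moreover have "retraction_step X (x, e) (id, g) = (id, g \<otimes> val [(x, e)])"
    using retraction_step_emit[OF dominant_state_id \<open>x \<in> X\<close>] id_apply by metis
  moreover have "fold (retraction_step X) u (id, g \<otimes> val [(x, e)]) = (id, g \<otimes> val [(x, e)] \<otimes> val u)"
    using calculation Cons.prems(2) by (intro Cons.IH) auto
  moreover have "g \<otimes> val [(x, e)] \<otimes> val u = g \<otimes> val (p # u)"
    using calculation Cons.prems(2) by (simp add: p m_assoc val_Cons[of x u])
  ultimately show ?case by (simp only: p fold_simps)
qed simp

lemma retraction_outside:
  assumes "t \<in> S" "t \<notin> X"
  shows "retraction_step X (t, e) (id, g) = (reflection t, g)"
  using assms retraction_step_move[of X id t e g] by (auto simp: simple_root_inj)

text \<open>
  Words over \<open>X\<close> fix the base state, whereas a generator outside \<open>X\<close> moves it.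
\<close>

lemma generator_notin_parabolic:
  assumes X: "X \<subseteq> S" and t: "t \<in> S" "t \<notin> X"
  shows "val [(t, e)] \<notin> parabolic X"
proof
  assume "val [(t, e)] \<in> parabolic X"
  then obtain u where u: "u \<in> group_words X" "val [(t, e)] = val u" by (auto simp: parabolic_def)
  have "fold (retraction_step X) [(t, e)] (id, \<one>) = fold (retraction_step X) u (id, \<one>)"
    using u t group_words_mono[OF X] dominant_state_id by (intro retraction_cong[OF X]) auto
  then have "reflection t = id"
    using retraction_fixes[OF X u(1), of \<one>] retraction_outside[OF t] by simp
  then have "simple_root t t = - simple_root t t"
    using reflection_own_root[OF t(1)] by (metis id_apply)
  then show False by (simp add: simple_root_def)
qed

section \<open>Central elements in proper parabolic subgroups\<close>

text \<open>
  Apply the retraction to the two words \<open>z t\<close> and \<open>t z\<close>. The first gives \<open>z\<close>, as \<open>t\<close> comes last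
  and emits nothing. In the second, \<open>t\<close> comes first and moves the state to \<open>reflection t\<close>. The
  letters of \<open>z\<close> then act by words \<open>ks\<close> over \<open>X\<close> on the left of that reflection, and such words do
  not affect the coordinate at \<open>t\<close>. A generator \<open>x\<close> is emitted only if the reflection of \<open>t\<close>
  leaves the simple root of \<open>x\<close> without a component at \<open>t\<close>, that is, if \<open>x\<close> and \<open>t\<close> commute.
\<close>

theorem commuting_generator_parabolic:
  assumes X: "X \<subseteq> S" and t: "t \<in> S" "t \<notin> X"
    and z: "z \<in> parabolic X" "z \<otimes> val [(t, True)] = val [(t, True)] \<otimes> z"
  shows "z \<in> parabolic {x \<in> X. M x t = 2}"
proof -
  let ?Y = "{x \<in> X. M x t = 2}"
  from z(1) obtain u where u: "u \<in> group_words X" "z = val u" by (auto simp: parabolic_def)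
  have uS: "u \<in> group_words S" using u(1) group_words_mono[OF X] by blast
  have "fold (retraction_step X) (u @ [(t, True)]) (id, \<one>) = fold (retraction_step X) ([(t, True)] @ u) (id, \<one>)"
    using z(2) uS t dominant_state_id val_append[of u "[(t, True)]"] val_Cons[of t u True]
    by (intro retraction_cong[OF X]) (auto simp: u(2))
  then have eq: "(reflection t, z) = fold (retraction_step X) u (reflection t, \<one>)"
    using retraction_fixes[OF X u(1), of \<one>] retraction_outside[OF t] uS by (simp add: u(2))
  have gen: "\<exists>ks\<in>lists X. \<exists>w\<in>group_words ?Y.
      fold (retraction_step X) u (reflection t, \<one>) = (word_map ks \<circ> reflection t, val w)"
    if "u \<in> group_words X" for u
    using that
  proof (induction u rule: rev_induct)
    case Nil
    have "[] \<in> group_words ?Y" by simp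
    then show ?case
      by (intro bexI[of _ "[]"] bexI[of _ "[] :: 'a group_word"]) (auto simp: fun_eq_iff)
  next
    case (snoc p u)
    obtain s e where p: "p = (s, e)" by (cases p)
    have s: "s \<in> X" "u \<in> group_words X" using snoc.prems p by auto
    from snoc.IH[OF s(2)] obtain ks w where ks: "ks \<in> lists X" "w \<in> group_words ?Y"
      "fold (retraction_step X) u (reflection t, \<one>) = (word_map ks \<circ> reflection t, val w)"
      by blast
    have ksS: "ks \<in> lists S" using ks(1) lists_mono[OF X] by blast
    define v where "v = word_map ks \<circ> reflection t"
    have dom: "v \<in> dominant_states X"
    proof -
      from retraction_fold_closed[OF X, of "(t, True) # u" "(id, \<one>)"] s(2) group_words_mono[OF X] t dominant_state_id
      show ?thesis using retraction_outside[OF t] ks(3) by (auto simp: v_def)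
    qed
    show ?case
    proof (cases "\<exists>x\<in>X. v (simple_root x) = simple_root s")
      case True
      then obtain x where x: "x \<in> X" "v (simple_root x) = simple_root s" by blast
      have xS: "x \<in> S" using x X by blast
      have "reflection t (simple_root x) = word_map (rev ks) (simple_root s)"
        using x(2) word_map_rev[OF ksS] unfolding v_def comp_apply by metis
      moreover have "word_map (rev ks) (simple_root s) t = simple_root s t"
      proof -
        have "word_map ls w t = w t" if "ls \<in> lists X" for ls w
          using that t(2) by (induction ls) (auto simp: reflection_def simple_root_def)
        then show ?thesis using ks(1) by (simp add: in_lists_conv_set)
      qed
      ultimately have "reflection t (simple_root x) t = 0"
        using s(1) t(2) by (auto simp: simple_root_def)
      then have "gram t x = 0"
        using fun_cong[OF reflection_simple_root[OF xS, of t], of t] x(1) t(2)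
        by (cases "t = x") (auto simp: simple_root_def)
      then have "cos (pi / real (finite_label t x)) = cos (pi / real 2)" by (simp add: gram_def)
      then have "finite_label t x = 2"
        using label_ge_2[OF t(1) xS] t(2) x(1) by (intro cos_pi_over_inj) fastforce+
      then have "finite_label x t = 2" using label_sym[OF t(1) xS] by simp
      then have "M x t = 2"
        by (auto simp: finite_label_def big_label_def numeral_eq_enat split: enat.splits)
      then have "w @ [(x, e)] \<in> group_words ?Y" using x ks(2) by auto
      moreover have "val (w @ [(x, e)]) = val w \<otimes> val [(x, e)]"
        using ks(2) xS group_words_mono[of ?Y S] X by (intro val_append) auto
      moreover have "fold (retraction_step X) (u @ [p]) (reflection t, \<one>) = (v, val w \<otimes> val [(x, e)])"
        by (simp add: p ks(3)[folded v_def] retraction_step_emit[OF dom x])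
      ultimately show ?thesis
        using ks(1) by (intro bexI[of _ ks] bexI[of _ "w @ [(x, e)]"]) (auto simp: v_def)
    next
      case False
      have "fold (retraction_step X) (u @ [p]) (reflection t, \<one>) = (word_map (s # ks) \<circ> reflection t, val w)"
      proof -
        have "retraction_step X (s, e) (v, val w) = (reflection s \<circ> v, val w)"
          using False by (intro retraction_step_move) blast
        then show ?thesis by (simp add: p ks(3)[folded v_def]) (simp add: v_def o_assoc)
      qed
      then show ?thesis
        using ks s(1) by (intro bexI[of _ "s # ks"] bexI[of _ w]) auto
    qed
  qed
  from gen[OF u(1)] eq show ?thesis by (auto simp: parabolic_def)
qed

text \<open>
  By connectedness a nonempty proper subset \<open>X\<close> has a neighbour \<open>t\<close> outside. A central element in
  the subgroup of \<open>X\<close> already lies in the subgroup of those vertices of \<open>X\<close> that are not joined to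
  \<open>t\<close>, so \<open>X\<close> shrinks until it is empty.
\<close>

theorem center_inter_proper_parabolic:
  assumes conn: "coxeter_connected S M"
    and X: "X \<subset> S" and z: "z \<in> group_center A" "z \<in> parabolic X"
  shows "z = \<one>"
proof -
  have "finite X" using X finite_vertices finite_subset by blast
  then show ?thesis using X z(2)
  proof (induction X rule: finite_psubset_induct)
    case (psubset X)
    show ?case
    proof (cases "X = {}")
      case True
      then show ?thesis using psubset.prems by (auto simp: parabolic_def group_words_def)
    next
      case False
      then obtain x y where xy: "x \<in> X" "y \<in> S - X" using psubset.prems by blast
      have "(x, y) \<in> (coxeter_edges S M)\<^sup>*" using conn xy psubset.prems by (auto simp: coxeter_connected_def)
      then have "y \<in> X \<or> (\<exists>x t. x \<in> X \<and> t \<notin> X \<and> (x, t) \<in> coxeter_edges S M)"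
        by (induction rule: rtrancl_induct) (use xy(1) in blast)+
      then obtain x t where xt: "x \<in> X" "t \<notin> X" "(x, t) \<in> coxeter_edges S M"
        using xy(2) by blast
      then have t: "t \<in> S" "3 \<le> M x t" by (auto simp: coxeter_edges_def)
      let ?Y = "{x \<in> X. M x t = 2}"
      have "M x t \<noteq> 2" using t(2) by auto
      then have "?Y \<subset> X" using xt(1) by blast
      moreover have "z \<in> parabolic ?Y"
        using psubset.prems z(1) t(1) xt(2)
        by (intro commuting_generator_parabolic) (auto simp: group_center_def)
      ultimately show ?thesis using psubset.IH[of ?Y] psubset.prems by blast
    qed
  qed
qed

end

section \<open>Centres of amalgams\<close>

text \<open>
  Products of elements taken alternately from \<open>F True\<close> and \<open>F False\<close>, outside of \<open>C\<close>. The two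
  Boolean parameters are the sides of the first and of the last factor.
\<close>

inductive alternating_product ::
    "('g, 'r) monoid_scheme \<Rightarrow> (bool \<Rightarrow> 'g set) \<Rightarrow> 'g set \<Rightarrow> bool \<Rightarrow> bool \<Rightarrow> 'g \<Rightarrow> bool"
  for G F C where
  single: "f \<in> F b - C \<Longrightarrow> alternating_product G F C b b f"
| snoc: "alternating_product G F C b (\<not> e) a \<Longrightarrow> f \<in> F e - C \<Longrightarrow>
    alternating_product G F C b e (a \<otimes>\<^bsub>G\<^esub> f)"

locale two_subgroups = group G for G (structure) +
  fixes F :: "bool \<Rightarrow> 'a set" and C :: "'a set"
  assumes subgroup_F: "subgroup (F b) G" and subgroup_C: "subgroup C G" and C_subset: "C \<subseteq> F b"
begin

abbreviation "alt \<equiv> alternating_product G F C"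

lemma F_closed: "f \<in> F b \<Longrightarrow> f \<in> carrier G"
  using subgroup.mem_carrier[OF subgroup_F] .

lemma alt_closed: "alt b e a \<Longrightarrow> a \<in> carrier G"
  by (induction rule: alternating_product.induct) (auto dest: F_closed)

lemma F_diff_mult_C: "f \<in> F b - C \<Longrightarrow> c \<in> C \<Longrightarrow> f \<otimes> c \<in> F b - C"
  using subgroup.m_closed[OF subgroup_F, of f b c] C_subset F_closed[of f b]
    subgroup.m_closed[OF subgroup_C, of "f \<otimes> c" "inv c"]
    subgroup.m_inv_closed[OF subgroup_C, of c] subgroup.mem_carrier[OF subgroup_C, of c]
  by (auto simp: m_assoc)

lemma alt_absorb: "alt b e a \<Longrightarrow> c \<in> C \<Longrightarrow> alt b e (a \<otimes> c)"
proof (induction rule: alternating_product.cases)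
  case (single f b)
  then show ?case using F_diff_mult_C by (auto intro: alternating_product.single)
next
  case (snoc b e a f)
  then have "a \<otimes> f \<otimes> c = a \<otimes> (f \<otimes> c)"
    using alt_closed F_closed subgroup.mem_carrier[OF subgroup_C] by (intro m_assoc) auto
  with snoc show ?case using F_diff_mult_C by (auto intro: alternating_product.snoc)
qed

lemma alt_or_C_mult:
  assumes "a \<in> C \<or> (\<exists>b e. alt b e a)" "f \<in> F b'"
  shows "a \<otimes> f \<in> C \<or> (\<exists>b e. alt b e (a \<otimes> f))"
proof -
  have F: "g \<otimes> f \<in> C \<or> (\<exists>b e. alt b e (g \<otimes> f))" if "g \<in> F b'" for g
    using subgroup.m_closed[OF subgroup_F that assms(2)] alternating_product.single[of "g \<otimes> f" F b' C G]
    by blast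
  from assms(1) show ?thesis
  proof (elim disjE exE)
    assume "a \<in> C"
    then show ?thesis using F C_subset by blast
  next
    fix b e assume a: "alt b e a"
    show ?thesis
    proof (cases "b' = e")
      case False
      then have "alt b (\<not> b') a" using a by (cases b'; cases e) auto
      then show ?thesis
        using assms(2) alt_absorb[OF a] alternating_product.snoc[of G F C b b' a f] by blast
    next
      case True
      from a show ?thesis
      proof cases
        case single
        then show ?thesis using F True by auto
      next
        case (snoc a0 f0)
        have eq: "a \<otimes> f = a0 \<otimes> (f0 \<otimes> f)"
          using snoc alt_closed F_closed assms(2) by (auto simp: m_assoc)
        have "f0 \<otimes> f \<in> F e" using snoc assms(2) True subgroup.m_closed[OF subgroup_F] by auto
        then show ?thesis
          unfolding eq using alt_absorb[OF snoc(2)] alternating_product.snoc[OF snoc(2), of "f0 \<otimes> f"] by blast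
      qed
    qed
  qed
qed

text \<open>
  Under the ping-pong conditions an alternating product from side \<open>b\<close> to side \<open>e\<close> maps \<open>R (\<not> b)\<close>
  into \<open>R e\<close>. To exclude a central alternating product \<open>z\<close> it does not suffice to compare regions,
  since \<open>z\<close> could just exchange them. Hence the points \<open>q b\<close>, whose orbit under \<open>F b\<close> never
  leaves \<open>R b\<close>. If \<open>b = e\<close>, take \<open>f\<close> on the other side; then \<open>z f\<close> and \<open>f z\<close> send
  \<open>q (\<not> b)\<close> to different regions. Otherwise \<open>z = a f\<close>, and the equation \<open>a = f\<^sup>-\<^sup>1 z\<close> is contradicted
  at \<open>q (\<not> b)\<close>.
\<close>

lemma ping_pong_center:
  fixes act :: "'a \<Rightarrow> 'p \<Rightarrow> 'p" and R :: "bool \<Rightarrow> 'p set" and q :: "bool \<Rightarrow> 'p"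
  assumes act_mult: "\<And>a b c p. a \<in> carrier G \<Longrightarrow> b \<in> carrier G \<Longrightarrow> p \<in> R c \<Longrightarrow>
      act (a \<otimes> b) p = act b (act a p)"
    and disj: "\<And>b. R b \<inter> R (\<not> b) = {}"
    and swap: "\<And>f b p. f \<in> F b - C \<Longrightarrow> p \<in> R (\<not> b) \<Longrightarrow> act f p \<in> R b"
    and stay: "\<And>f b. f \<in> F b \<Longrightarrow> act f (q b) \<in> R b"
    and q: "\<And>b. q b \<in> R b"
    and nontriv: "\<And>b. \<exists>f. f \<in> F b - C"
    and z: "z \<in> group_center G" "z \<in> C \<or> (\<exists>b e. alt b e z)"
  shows "z \<in> C"
proof (rule ccontr)
  assume "z \<notin> C"
  with z(2) obtain b e where alt: "alt b e z" by blast
  have zc: "z \<in> carrier G" and comm: "\<And>g. g \<in> carrier G \<Longrightarrow> z \<otimes> g = g \<otimes> z"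
    using z(1) by (auto simp: group_center_def)
  have moves: "act a p \<in> R e" if "alt b e a" "p \<in> R (\<not> b)" for a p b e
    using that
  proof (induction arbitrary: p rule: alternating_product.induct)
    case (snoc b e a f)
    then have "act (a \<otimes> f) p = act f (act a p)"
      using act_mult[OF alt_closed F_closed] by blast
    moreover have "act f (act a p) \<in> R e"
      using swap[OF snoc.hyps(2)] snoc.IH[OF snoc.prems] by simp
    ultimately show ?case by simp
  qed (rule swap)
  show False
  proof (cases "b = e")
    case True
    obtain f where f: "f \<in> F (\<not> b) - C" using nontriv by blast
    let ?v = "q (\<not> b)"
    have "act (z \<otimes> f) ?v = act f (act z ?v)"
      using act_mult zc F_closed f q by blast
    moreover have "act f (act z ?v) \<in> R (\<not> b)"
      using swap[OF f] moves[OF alt q] True by simp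
    moreover have "act (f \<otimes> z) ?v = act z (act f ?v)"
      using act_mult zc F_closed f q by blast
    moreover have "act z (act f ?v) \<in> R b"
      using moves[OF alt stay] f True by auto
    ultimately show False using comm[of f] F_closed f disj[of b] by auto
  next
    case False
    then have e: "e = (\<not> b)" by auto
    from alt show False
    proof cases
      case single
      with False show False by simp
    next
      case (snoc a f)
      then have ab: "alt b b a" using e by simp
      have ac: "a \<in> carrier G" and fc: "f \<in> carrier G" using alt_closed[OF ab] F_closed snoc by auto
      let ?v = "q (\<not> b)"
      have fi: "inv f \<in> F (\<not> b)"
        using subgroup.m_inv_closed[OF subgroup_F] snoc e by auto
      have "inv f \<otimes> z = a"
        using comm[of "inv f"] snoc ac fc by (simp add: m_assoc)
      then have "act a ?v = act z (act (inv f) ?v)"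
        using act_mult[of "inv f" z ?v "\<not> b"] zc fc q by simp
      moreover have "act z (act (inv f) ?v) \<in> R (\<not> b)"
        using moves[OF alt stay[OF fi]] e by simp
      moreover have "act a ?v \<in> R b" using moves[OF ab q] .
      ultimately show False using disj[of b] by auto
    qed
  qed
qed

end

context group
begin

text \<open>
  The free right action of \<open>C\<close> on \<open>C \<times> bool \<times> nat\<close> extends to an action of the larger group \<open>F\<close>.
  Indeed \<open>F \<times> nat \<times> bool\<close> with right multiplication is a free \<open>C\<close>-set with countably many
  orbits, indexed by left cosets \<open>\<kappa> g\<close> together with the last two components, and a free action is
  determined by its set of orbits. The bijection \<open>\<beta>\<close> between the sets of orbits is chosen so that
  the region with label \<open>\<not> b\<close> consists of the copies of \<open>C\<close> itself with last component \<open>False\<close>.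
  Elements of \<open>F - C\<close> throw it into the other region, and the copies with last component \<open>True\<close>
  provide whole \<open>F\<close>-orbits inside that other region.
\<close>

lemma coset_action_extension:
  fixes b :: bool
  assumes F: "subgroup F G" "countable F" and C: "subgroup C G" "C \<subseteq> F"
  shows "\<exists>act q. (\<forall>f\<in>F. \<forall>p\<in>C \<times> UNIV. act f p \<in> C \<times> UNIV) \<and>
    (\<forall>f\<in>F. \<forall>f'\<in>F. \<forall>p\<in>C \<times> UNIV. act (f \<otimes> f') p = act f' (act f p)) \<and>
    (\<forall>p\<in>C \<times> UNIV. act \<one> p = p) \<and>
    (\<forall>c\<in>C. \<forall>d\<in>C. \<forall>i. act c (d, i) = (d \<otimes> c, i)) \<and>
    (\<forall>f\<in>F - C. \<forall>p\<in>C \<times> {\<not> b} \<times> UNIV. act f p \<in> C \<times> {b} \<times> UNIV) \<and>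
    q \<in> C \<times> {b} \<times> UNIV \<and> (\<forall>f\<in>F. act f q \<in> C \<times> {b} \<times> (UNIV :: nat set))"
proof -
  define \<kappa> where "\<kappa> g = (\<lambda>c. g \<otimes> c) ` C" for g
  define r where "r K = (SOME x. x \<in> K)" for K :: "'a set"
  define \<gamma> where "\<gamma> g = inv (r (\<kappa> g)) \<otimes> g" for g
  note Fc [simp] = subgroup.mem_carrier[OF F(1)]
  note Cc [simp] = subgroup.mem_carrier[OF C(1)]
  have CF [simp]: "c \<in> F" if "c \<in> C" for c using that C(2) by blast
  note cl [simp] = subgroup.m_closed[OF C(1)] subgroup.m_inv_closed[OF C(1)] subgroup.one_closed[OF C(1)]
    subgroup.m_closed[OF F(1)]
  have \<kappa>_mult: "\<kappa> (g \<otimes> c) = \<kappa> g" if "g \<in> F" "c \<in> C" for g c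
  proof
    show "\<kappa> (g \<otimes> c) \<subseteq> \<kappa> g"
      using that by (auto simp: \<kappa>_def m_assoc)
    show "\<kappa> g \<subseteq> \<kappa> (g \<otimes> c)"
    proof
      fix x assume "x \<in> \<kappa> g"
      then obtain d where d: "d \<in> C" "x = g \<otimes> d" by (auto simp: \<kappa>_def)
      then have "x = g \<otimes> c \<otimes> (inv c \<otimes> d)" using that by (simp add: m_assoc flip: m_assoc[of c])
      then show "x \<in> \<kappa> (g \<otimes> c)" using d that by (auto simp: \<kappa>_def)
    qed
  qed
  have rep: "\<exists>c\<in>C. r (\<kappa> g) = g \<otimes> c" if "g \<in> F" for g
  proof -
    have "g \<in> \<kappa> g" unfolding \<kappa>_def using that by (intro image_eqI[of _ _ \<one>]) auto
    then have "r (\<kappa> g) \<in> \<kappa> g" unfolding r_def by (rule someI)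
    then show ?thesis by (auto simp: \<kappa>_def)
  qed
  have r: "r (\<kappa> g) \<in> F" "\<kappa> (r (\<kappa> g)) = \<kappa> g" if "g \<in> F" for g
    using rep[OF that] that \<kappa>_mult by auto
  have \<gamma>: "\<gamma> g \<in> C" "r (\<kappa> g) \<otimes> \<gamma> g = g" if g: "g \<in> F" for g
  proof -
    obtain c where "c \<in> C" "r (\<kappa> g) = g \<otimes> c" using rep[OF g] by blast
    with g show "\<gamma> g \<in> C" unfolding \<gamma>_def
      by (simp add: inv_mult_group m_assoc)
    show "r (\<kappa> g) \<otimes> \<gamma> g = g"
      using r(1)[OF g] g unfolding \<gamma>_def by (simp flip: m_assoc)
  qed
  have \<gamma>_mult: "\<gamma> (g \<otimes> c) = \<gamma> g \<otimes> c" if "g \<in> F" "c \<in> C" for g c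
    using that r(1)[OF that(1)] unfolding \<gamma>_def by (simp add: \<kappa>_mult m_assoc)
  have \<kappa>_C: "\<kappa> g = \<kappa> \<one> \<longleftrightarrow> g \<in> C" if "g \<in> F" for g
  proof
    assume eq: "\<kappa> g = \<kappa> \<one>"
    have "g \<in> \<kappa> g" unfolding \<kappa>_def using that by (intro image_eqI[of _ _ \<one>]) auto
    then show "g \<in> C" unfolding eq by (auto simp: \<kappa>_def)
  next
    assume "g \<in> C"
    then show "\<kappa> g = \<kappa> \<one>" using \<kappa>_mult[of \<one> g] by simp
  qed
  define V where "V = {\<kappa> \<one>} \<times> (UNIV :: nat set) \<times> {False}"
  define D where "D = \<kappa> ` F \<times> (UNIV :: nat set) \<times> (UNIV :: bool set) - V"
  have "countable D" unfolding D_def using F(2) by (intro countable_Diff) simp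
  moreover have "infinite D"
  proof
    assume "finite D"
    moreover have "(\<lambda>n. (\<kappa> \<one>, n, True)) ` UNIV \<subseteq> D" by (auto simp: D_def V_def)
    ultimately have "finite ((\<lambda>n :: nat. (\<kappa> \<one>, n, True)) ` UNIV)" by (rule rev_finite_subset)
    then show False by (auto dest!: finite_imageD simp: inj_on_def)
  qed
  ultimately have toD: "bij_betw (to_nat_on D) D UNIV" by (rule to_nat_on_infinite)
  define \<beta> where "\<beta> i = (if i \<in> V then (\<not> b, fst (snd i)) else (b, to_nat_on D i))" for i
  have \<beta>: "bij_betw \<beta> (V \<union> D) UNIV"
  proof -
    have "bij_betw \<beta> V ({\<not> b} \<times> UNIV)"
      by (rule bij_betw_byWitness[of _ "\<lambda>(_, n). (\<kappa> \<one>, n, False)"]) (auto simp: \<beta>_def V_def)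
    moreover have "bij_betw \<beta> D ({b} \<times> UNIV)"
    proof -
      have "bij_betw (Pair b \<circ> to_nat_on D) D ({b} \<times> UNIV)"
        using toD by (rule bij_betw_trans) (auto simp: bij_betw_def inj_on_def)
      then show ?thesis by (rule bij_betw_cong[THEN iffD1, rotated]) (auto simp: \<beta>_def D_def)
    qed
    ultimately have "bij_betw \<beta> (V \<union> D) ({\<not> b} \<times> UNIV \<union> {b} \<times> UNIV)"
      by (rule bij_betw_combine) auto
    moreover have "{\<not> b} \<times> UNIV \<union> {b} \<times> UNIV = (UNIV :: (bool \<times> nat) set)" by auto
    ultimately show ?thesis by simp
  qed
  have VD: "V \<union> D = \<kappa> ` F \<times> UNIV" by (auto simp: V_def D_def)
  define \<Psi> where "\<Psi> = (\<lambda>(g, i). (\<gamma> g, \<beta> (\<kappa> g, i)))"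
  have bij: "bij_betw \<Psi> (F \<times> UNIV) (C \<times> UNIV)"
  proof (rule bij_betw_imageI)
    show "inj_on \<Psi> (F \<times> UNIV)"
    proof (rule inj_onI)
      fix p p' :: "'a \<times> nat \<times> bool"
      assume "p \<in> F \<times> UNIV" "p' \<in> F \<times> UNIV" "\<Psi> p = \<Psi> p'"
      then obtain g n e g' n' e' where p: "p = (g, n, e)" "p' = (g', n', e')"
        and g: "g \<in> F" "g' \<in> F" and eq: "\<Psi> (g, n, e) = \<Psi> (g', n', e')"
        by (cases p; cases p') auto
      have "(\<kappa> g, n, e) = (\<kappa> g', n', e')"
        using eq g bij_betw_imp_inj_on[OF \<beta>] unfolding VD \<Psi>_def by (auto dest: inj_onD)
      then have \<kappa>: "\<kappa> g = \<kappa> g'" and ne: "n = n'" "e = e'" by simp_all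
      have "\<gamma> g = \<gamma> g'" using eq by (simp add: \<Psi>_def)
      then have "g = g'" using \<gamma>(2)[OF g(1)] \<gamma>(2)[OF g(2)] \<kappa> by metis
      with ne show "p = p'" by (simp add: p)
    qed
    show "\<Psi> ` (F \<times> UNIV) = C \<times> UNIV"
    proof
      show "\<Psi> ` (F \<times> UNIV) \<subseteq> C \<times> UNIV" using \<gamma>(1) by (auto simp: \<Psi>_def)
      show "C \<times> UNIV \<subseteq> \<Psi> ` (F \<times> UNIV)"
      proof clarify
        fix c x n assume c: "c \<in> C"
        have "(x, n) \<in> \<beta> ` (\<kappa> ` F \<times> UNIV)" using \<beta> unfolding VD bij_betw_def by simp
        then obtain g i where gi: "g \<in> F" "(x, n) = \<beta> (\<kappa> g, i)" by auto
        have "\<kappa> (r (\<kappa> g) \<otimes> c) = \<kappa> g" using r gi c \<kappa>_mult by simp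
        moreover have "\<gamma> (r (\<kappa> g) \<otimes> c) = c"
          using calculation r(1)[OF gi(1)] c unfolding \<gamma>_def by (simp flip: m_assoc)
        ultimately have "\<Psi> (r (\<kappa> g) \<otimes> c, i) = (c, x, n)" using gi by (simp add: \<Psi>_def)
        then show "(c, x, n) \<in> \<Psi> ` (F \<times> UNIV)"
          using r(1)[OF gi(1)] c by (intro image_eqI[of _ _ "(r (\<kappa> g) \<otimes> c, i)"]) auto
      qed
    qed
  qed
  define act where "act f p = (case inv_into (F \<times> UNIV) \<Psi> p of (g, i) \<Rightarrow> \<Psi> (g \<otimes> f, i))" for f p
  have act: "act f (\<Psi> (g, i)) = \<Psi> (g \<otimes> f, i)" if "g \<in> F" for f g i
    using inv_into_f_f[OF bij_betw_imp_inj_on[OF bij], of "(g, i)"] that by (simp add: act_def)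
  have ex: "\<exists>g i. g \<in> F \<and> p = \<Psi> (g, i)" if "p \<in> C \<times> UNIV" for p
  proof -
    have "p \<in> \<Psi> ` (F \<times> UNIV)" using that bij unfolding bij_betw_def by simp
    then show ?thesis by blast
  qed
  have \<Psi>_in: "\<Psi> (g, i) \<in> C \<times> UNIV" if "g \<in> F" for g i
    using that \<gamma>(1) by (simp add: \<Psi>_def)
  let ?q = "\<Psi> (\<one>, 0, True)"
  have True_b: "\<Psi> (g, n, True) \<in> C \<times> {b} \<times> UNIV" if "g \<in> F" for g n
    using that \<gamma>(1) by (simp add: \<Psi>_def \<beta>_def V_def)
  have one: "\<one> \<in> F" by simp
  show ?thesis
  proof (intro exI[of _ act] exI[of _ ?q] conjI ballI allI)
    fix f p assume "f \<in> F" "p \<in> C \<times> (UNIV :: (bool \<times> nat) set)"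
    then show "act f p \<in> C \<times> UNIV" using ex[of p] act \<Psi>_in by auto
  next
    fix f f' p assume "f \<in> F" "f' \<in> F" "p \<in> C \<times> (UNIV :: (bool \<times> nat) set)"
    then show "act (f \<otimes> f') p = act f' (act f p)" using ex[of p] act by (auto simp: m_assoc)
  next
    fix p assume "p \<in> C \<times> (UNIV :: (bool \<times> nat) set)"
    then show "act \<one> p = p" using ex[of p] act by auto
  next
    fix c d i assume cd: "c \<in> C" "d \<in> C"
    then obtain g j where g: "g \<in> F" "(d, i) = \<Psi> (g, j)" using ex[of "(d, i)"] by auto
    then show "act c (d, i) = (d \<otimes> c, i)"
      using act[OF g(1)] cd by (auto simp: \<Psi>_def \<gamma>_mult \<kappa>_mult)
  next
    fix f p assume f: "f \<in> F - C" and p: "p \<in> C \<times> {\<not> b} \<times> (UNIV :: nat set)"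
    then obtain g n e where g: "g \<in> F" "p = \<Psi> (g, n, e)" using ex[of p] by auto
    with p have "(\<kappa> g, n, e) \<in> V" by (auto simp: \<Psi>_def \<beta>_def split: if_splits)
    then have "g \<in> C" using \<kappa>_C[OF g(1)] by (auto simp: V_def)
    have "g \<otimes> f \<notin> C"
    proof
      assume "g \<otimes> f \<in> C"
      then have "inv g \<otimes> (g \<otimes> f) \<in> C" using \<open>g \<in> C\<close> by simp
      then show False using f \<open>g \<in> C\<close> by (simp flip: m_assoc)
    qed
    then have "(\<kappa> (g \<otimes> f), n, e) \<notin> V" using \<kappa>_C[of "g \<otimes> f"] f g by (auto simp: V_def)
    then show "act f p \<in> C \<times> {b} \<times> UNIV"
      using act[OF g(1)] g \<gamma>(1)[of "g \<otimes> f"] f by (auto simp: \<Psi>_def \<beta>_def)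
  next
    show "?q \<in> C \<times> {b} \<times> UNIV" using True_b one by blast
  next
    fix f assume "f \<in> F"
    then show "act f ?q \<in> C \<times> {b} \<times> UNIV" using act[OF one] True_b by simp
  qed
qed

end

section \<open>Coxeter graphs with an infinite label\<close>

context artin_tits
begin

lemma countable_parabolic: "X \<subseteq> S \<Longrightarrow> countable (parabolic X)"
  unfolding parabolic_def group_words_def
  using finite_vertices by (intro countable_image countable_lists countable_SIGMA)
    (auto intro: countable_finite finite_subset)

text \<open>
  There is no relation between \<open>s\<close> and \<open>t\<close>, so the Artin-Tits group is the amalgam of the subgroups
  generated by \<open>S - {s}\<close> and by \<open>S - {t}\<close> over the one generated by \<open>S - {s, t}\<close>. What is used of this
  is that any two actions of the factors on one set that agree on \<open>C\<close> combine to an action of the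
  whole group: every defining relation lives in one of the factors. The factors are taken
  inside the group, so that \<open>C\<close> acts freely on both of them. Two extensions of the same free
  action of \<open>C\<close>, with opposite regions, combine to a ping-pong action.
\<close>

theorem center_subset_base:
  assumes st: "s \<in> S" "t \<in> S" "s \<noteq> t" "M s t = \<infinity>" and z: "z \<in> group_center A"
  shows "z \<in> parabolic (S - {s, t})"
proof -
  define F where "F b = parabolic (if b then S - {s} else S - {t})" for b
  define C where "C = parabolic (S - {s, t})"
  interpret two_subgroups A F C
  proof (intro two_subgroups.intro two_subgroups_axioms.intro)
    show "group A" by (rule group_axioms)
    show "subgroup (F b) A" for b unfolding F_def by (intro subgroup_parabolic) auto
    show "subgroup C A" unfolding C_def by (intro subgroup_parabolic) auto
    show "C \<subseteq> F b" for b unfolding C_def F_def by (intro parabolic_mono) auto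
  qed
  have "countable (F b)" for b unfolding F_def by (intro countable_parabolic) auto
  note extension = coset_action_extension[OF subgroup_F this subgroup_C C_subset]
  define P where "P b act q \<longleftrightarrow> (\<forall>f\<in>F b. \<forall>p\<in>C \<times> UNIV. act f p \<in> C \<times> UNIV) \<and>
    (\<forall>f\<in>F b. \<forall>f'\<in>F b. \<forall>p\<in>C \<times> UNIV. act (f \<otimes> f') p = act f' (act f p)) \<and>
    (\<forall>p\<in>C \<times> UNIV. act \<one> p = p) \<and>
    (\<forall>c\<in>C. \<forall>d\<in>C. \<forall>i. act c (d, i) = (d \<otimes> c, i)) \<and>
    (\<forall>f\<in>F b - C. \<forall>p\<in>C \<times> {\<not> b} \<times> UNIV. act f p \<in> C \<times> {b} \<times> UNIV) \<and>
    q \<in> C \<times> {b} \<times> UNIV \<and> (\<forall>f\<in>F b. act f q \<in> C \<times> {b} \<times> (UNIV :: nat set))" for b act q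
  have "\<forall>b. \<exists>act q. P b act q"
    unfolding P_def by (intro allI extension)
  then obtain act q where P: "P b (act b) (q b)" for b
    by metis
  have
    closed: "act b f p \<in> C \<times> UNIV" if "f \<in> F b" "p \<in> C \<times> UNIV" for b f p
    using P[of b] that unfolding P_def by blast
  have mult: "act b (f \<otimes> f') p = act b f' (act b f p)"
    if "f \<in> F b" "f' \<in> F b" "p \<in> C \<times> UNIV" for b f f' p
    using P[of b] that unfolding P_def by blast
  have one: "act b \<one> p = p" if "p \<in> C \<times> UNIV" for b p
    using P[of b] that unfolding P_def by blast
  have base: "act b c (d, i) = (d \<otimes> c, i)" if "c \<in> C" "d \<in> C" for b c d i
    using P[of b] that unfolding P_def by blast
  have swap: "act b f p \<in> C \<times> {b} \<times> UNIV"
    if "f \<in> F b - C" "p \<in> C \<times> {\<not> b} \<times> UNIV" for b f p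
    using P[of b] that unfolding P_def by blast
  have q: "q b \<in> C \<times> {b} \<times> UNIV" for b
    using P[of b] unfolding P_def by blast
  have stay: "act b f (q b) \<in> C \<times> {b} \<times> UNIV" if "f \<in> F b" for b f
    using P[of b] that unfolding P_def by blast
  define \<Omega> where "\<Omega> = C \<times> (UNIV :: (bool \<times> nat) set)"
  (* Only s must act as in the factor without t; the generators of C act alike on both sides. *)
  define step where "step p = act (fst p \<noteq> s) (val [p])" for p
  have gen_F: "val [(x, e)] \<in> F b" if "x \<in> (if b then S - {s} else S - {t})" for x e b
    using that unfolding F_def parabolic_def by (intro imageI) auto
  have step_eq: "step (x, e) p = act b (val [(x, e)]) p"
    if "x \<in> (if b then S - {s} else S - {t})" "p \<in> \<Omega>" for x e b p
  proof (cases "b = (x \<noteq> s)")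
    case False
    then have "x \<in> S - {s, t}" using that(1) by (auto split: if_splits)
    then have "val [(x, e)] \<in> C" unfolding C_def parabolic_def by (intro imageI) auto
    then show ?thesis using that(2) base by (auto simp: \<Omega>_def step_def)
  qed (simp add: step_def)
  have fold_step: "fold step u p = act b (val u) p"
    if "u \<in> group_words (if b then S - {s} else S - {t})" "p \<in> \<Omega>" for u b p
    using that
  proof (induction u arbitrary: p)
    case Nil
    then show ?case using one by (simp add: \<Omega>_def)
  next
    case (Cons l u)
    obtain x e where l: "l = (x, e)" by (cases l)
    have x: "x \<in> (if b then S - {s} else S - {t})" "u \<in> group_words (if b then S - {s} else S - {t})"
      using Cons.prems l by auto
    have xS: "x \<in> S" "u \<in> group_words S"
      using x group_words_mono[of "if b then S - {s} else S - {t}" S] by (auto split: if_splits)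
    have uF: "val u \<in> F b" unfolding F_def parabolic_def using x(2) by blast
    have "fold step (l # u) p = act b (val u) (act b (val [(x, e)]) p)"
      using Cons.IH[OF x(2), of "act b (val [(x, e)]) p"] closed[OF gen_F[OF x(1)]] Cons.prems(2)
        step_eq[OF x(1) Cons.prems(2)] by (simp add: l \<Omega>_def)
    also have "\<dots> = act b (val [(x, e)] \<otimes> val u) p"
      using mult[OF gen_F[OF x(1)] uF] Cons.prems(2) by (simp add: \<Omega>_def)
    finally show ?case using val_Cons[OF xS] by (simp add: l)
  qed
  have side: "\<exists>b. x \<in> (if b then S - {s} else S - {t})" if "x \<in> S" for x
    using that st(3) by (cases "x = s") (auto intro: exI[of _ False] exI[of _ True])
  have step_closed: "step (x, e) p \<in> \<Omega>" if "x \<in> S" "p \<in> \<Omega>" for x e p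
    using side[OF that(1)] step_eq[of x _ p e] closed gen_F that(2) unfolding \<Omega>_def by metis
  have cong: "fold step u p = fold step w p"
    if "(u, w) \<in> presentation_cong S (artin_relations S M)" "p \<in> \<Omega>" for u w p
  proof (rule presented_group_action[where act = step and \<Omega> = \<Omega> and X = S, OF _ _ _ that])
    show "step (x, e) p \<in> \<Omega>" if "x \<in> S" "p \<in> \<Omega>" for x e p
      using step_closed that .
  next
    fix x e p assume x: "x \<in> S" and p: "p \<in> \<Omega>"
    obtain b where b: "x \<in> (if b then S - {s} else S - {t})" using side[OF x] by blast
    have "fold step [(x, e), (x, \<not> e)] p = act b (val [(x, e), (x, \<not> e)]) p"
      using b by (intro fold_step[OF _ p]) auto
    also have "val [(x, e), (x, \<not> e)] = \<one>"
      using val_Cons[of x "[(x, \<not> e)]" e] val_cancel[OF x] x by simp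
    finally show "step (x, \<not> e) (step (x, e) p) = p" using one p by (simp add: \<Omega>_def)
  next
    fix l r p assume lr: "(l, r) \<in> artin_relations S M" and p: "p \<in> \<Omega>"
    then obtain x y k where xy: "x \<in> S" "y \<in> S" "x \<noteq> y" "M x y = enat k"
      "l = alternating_word (x, True) (y, True) k" "r = alternating_word (y, True) (x, True) k"
      unfolding artin_relations_def by auto
    have "M t s = \<infinity>" using st coxeter_matrix by (auto simp: coxeter_matrix_def)
    then have "{x, y} \<noteq> {s, t}" using xy st by (auto simp: doubleton_eq_iff)
    then have "{x, y} \<subseteq> (if s \<notin> {x, y} then S - {s} else S - {t})"
      using xy st(3) by (cases "s \<in> {x, y}") auto
    then obtain b where b: "{x, y} \<subseteq> (if b then S - {s} else S - {t})" by blast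
    have words: "alternating_word (x, True) (y, True) k \<in> group_words (if b then S - {s} else S - {t})"
      if "{x, y} \<subseteq> (if b then S - {s} else S - {t})" for x y
      using that set_alternating_word[of "(x, True)" "(y, True)" k]
      by (fastforce simp: group_words_def in_lists_conv_set)
    have "val l = val r" using val_alternating xy by simp
    then show "fold step l p = fold step r p"
      using fold_step[OF words p, of x y] fold_step[OF words p, of y x] b xy by auto
  qed
  define actA where "actA a = fold step (SOME u. u \<in> group_words S \<and> val u = a)" for a
  have actA: "actA (val u) p = fold step u p" if "u \<in> group_words S" "p \<in> \<Omega>" for u p
  proof -
    have "\<exists>w. w \<in> group_words S \<and> val w = val u" using that by blast
    from someI_ex[OF this] show ?thesis
      unfolding actA_def using cong that val_eq_iff by blast
  qed
  have actA_F: "actA f p = act b f p" if "f \<in> F b" "p \<in> \<Omega>" for f b p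
  proof -
    from that(1) obtain u where u: "u \<in> group_words (if b then S - {s} else S - {t})" "f = val u"
      unfolding F_def parabolic_def by blast
    moreover have "u \<in> group_words S"
      using u(1) group_words_mono[of "if b then S - {s} else S - {t}" S] by (auto split: if_splits)
    ultimately show ?thesis using actA fold_step that(2) by simp
  qed
  have "z \<in> C"
  proof (rule ping_pong_center[where act = actA and R = "\<lambda>b. C \<times> {b} \<times> UNIV" and q = q])
    fix a c p and b :: bool
    assume "a \<in> carrier A" "c \<in> carrier A" and p: "p \<in> C \<times> {b} \<times> (UNIV :: nat set)"
    then obtain u w where u: "u \<in> group_words S" "a = val u" "w \<in> group_words S" "c = val w"
      unfolding carrier_eq by blast
    have p\<Omega>: "p \<in> \<Omega>" using p by (auto simp: \<Omega>_def)
    have "fold step u p \<in> \<Omega>"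
      using step_closed u(1) p\<Omega> by (rule fold_group_word_closed)
    then show "actA (a \<otimes> c) p = actA c (actA a p)"
      using actA[of "u @ w" p] actA[of u p] actA[of w "fold step u p"] u p\<Omega>
      by (simp add: val_append)
  next
    show "C \<times> {b} \<times> UNIV \<inter> C \<times> {\<not> b} \<times> UNIV = {}" for b by auto
  next
    fix f b p assume "f \<in> F b - C" "p \<in> C \<times> {\<not> b} \<times> (UNIV :: nat set)"
    then show "actA f p \<in> C \<times> {b} \<times> UNIV"
      using actA_F[of f b p] swap by (auto simp: \<Omega>_def)
  next
    fix f b assume "f \<in> F b"
    then show "actA f (q b) \<in> C \<times> {b} \<times> UNIV"
      using actA_F[of f b "q b"] stay[of f b] q[of b] by (auto simp: \<Omega>_def)
  next
    show "q b \<in> C \<times> {b} \<times> UNIV" for b by (rule q)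
  next
    show "\<exists>f. f \<in> F b - C" for b
    proof -
      define x where "x = (if b then t else s)"
      have "val [(x, True)] \<in> F b" using st by (intro gen_F) (auto simp: x_def)
      moreover have "val [(x, True)] \<notin> C"
        unfolding C_def using st by (intro generator_notin_parabolic) (auto simp: x_def)
      ultimately show ?thesis by blast
    qed
  next
    show "z \<in> group_center A" by (rule z)
    have "val u \<in> C \<or> (\<exists>b e. alt b e (val u))" if "u \<in> group_words S" for u
      using that
    proof (induction u rule: rev_induct)
      case Nil
      then show ?case using subgroup.one_closed[OF subgroup_C] by simp
    next
      case (snoc l u)
      obtain x e where l: "l = (x, e)" by (cases l)
      have "x \<in> S" "u \<in> group_words S" using snoc.prems l by auto
      then show ?case
        using alt_or_C_mult[OF snoc.IH gen_F] side[of x] val_append[of u "[(x, e)]"] by (auto simp: l)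
    qed
    then show "z \<in> C \<or> (\<exists>b e. alt b e z)"
      using z by (auto simp: group_center_def carrier_eq)
  qed
  then show ?thesis by (simp add: C_def)
qed

end

section \<open>Relabelling of generators\<close>

lemma presentation_cong_map:
  assumes f: "f ` X \<subseteq> Y"
    and rel: "\<And>l r. (l, r) \<in> R \<Longrightarrow> (map (apfst f) l, map (apfst f) r) \<in> R'"
    and uv: "(u, v) \<in> presentation_cong X R"
  shows "(map (apfst f) u, map (apfst f) v) \<in> presentation_cong Y R'"
proof -
  have w: "map (apfst f) w \<in> group_words Y" if "w \<in> group_words X" for w
    using that f by (induction w) auto
  from uv show ?thesis
  proof (induction rule: presentation_cong.induct)
    case (cancel u v x e)
    then show ?case
      using presentation_cong.cancel[OF w[OF cancel(1)] w[OF cancel(2)], of "f x" e R'] f by auto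
  next
    case (relation u v l r)
    then show ?case
      using presentation_cong.relation[of "map (apfst f) u" Y "map (apfst f) v"
        "map (apfst f) l" "map (apfst f) r" R'] w rel by simp
  qed (auto intro: presentation_cong.refl presentation_cong.sym presentation_cong.trans w)
qed

text \<open>
  The vertices of a Coxeter graph may belong to any type, while the hypothesis of the final
  theorem speaks of natural numbers. A bijection of generators that respects the relations in
  both directions carries over finiteness and the triviality of the centre.
\<close>

locale presentation_relabelling =
  fixes X :: "'a set" and Y :: "'b set" and R :: "('a group_word \<times> 'a group_word) set"
    and R' :: "('b group_word \<times> 'b group_word) set" and f :: "'a \<Rightarrow> 'b" and g
  assumes f: "f ` X \<subseteq> Y" and g: "g ` Y \<subseteq> X"
    and gf: "x \<in> X \<Longrightarrow> g (f x) = x" and fg: "y \<in> Y \<Longrightarrow> f (g y) = y"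
    and rel_f: "(l, r) \<in> R \<Longrightarrow> (map (apfst f) l, map (apfst f) r) \<in> R'"
    and rel_g: "(l', r') \<in> R' \<Longrightarrow> (map (apfst g) l', map (apfst g) r') \<in> R"
begin

lemma map_f_words: "w \<in> group_words X \<Longrightarrow> map (apfst f) w \<in> group_words Y"
  using f by (induction w) auto

lemma map_g_words: "w \<in> group_words Y \<Longrightarrow> map (apfst g) w \<in> group_words X"
  using g by (induction w) auto

lemma map_g_f: "w \<in> group_words X \<Longrightarrow> map (apfst g) (map (apfst f) w) = w"
  using gf by (induction w) auto

lemma map_f_g: "w \<in> group_words Y \<Longrightarrow> map (apfst f) (map (apfst g) w) = w"
  using fg by (induction w) auto

lemma map_f_cong_iff:
  assumes "u \<in> group_words X" "v \<in> group_words X"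
  shows "(map (apfst f) u, map (apfst f) v) \<in> presentation_cong Y R' \<longleftrightarrow> (u, v) \<in> presentation_cong X R"
proof
  assume "(map (apfst f) u, map (apfst f) v) \<in> presentation_cong Y R'"
  from presentation_cong_map[OF g rel_g this] show "(u, v) \<in> presentation_cong X R"
    by (simp only: map_g_f assms)
qed (rule presentation_cong_map[OF f rel_f])

lemma finite_carrier:
  assumes fin: "finite (carrier (presented_group Y R'))"
  shows "finite (carrier (presented_group X R))"
proof -
  define h where "h w = presentation_cong Y R' `` {map (apfst f) w}" for w
  have "finite (h ` group_words X)"
  proof (rule finite_subset[OF _ fin])
    show "h ` group_words X \<subseteq> carrier (presented_group Y R')"
      using map_f_words by (auto simp: h_def presented_group_def quotient_def)
  qed
  then have "finite ((\<lambda>K. presentation_cong X R `` {SOME w. w \<in> group_words X \<and> h w = K}) ` h ` group_words X)"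
    by (rule finite_imageI)
  moreover have "carrier (presented_group X R) \<subseteq>
      (\<lambda>K. presentation_cong X R `` {SOME w. w \<in> group_words X \<and> h w = K}) ` h ` group_words X"
  proof
    fix K assume "K \<in> carrier (presented_group X R)"
    then obtain u where u: "u \<in> group_words X" "K = presentation_cong X R `` {u}"
      by (auto simp: presented_group_def quotient_def)
    define w where "w = (SOME w. w \<in> group_words X \<and> h w = h u)"
    have w: "w \<in> group_words X" "h w = h u"
      unfolding w_def using someI[of "\<lambda>w. w \<in> group_words X \<and> h w = h u" u] u(1) by auto
    then have "(map (apfst f) w, map (apfst f) u) \<in> presentation_cong Y R'"
      using eq_equiv_class_iff[OF equiv_presentation_cong] map_f_words u(1) unfolding h_def by blast
    then have "(w, u) \<in> presentation_cong X R" using map_f_cong_iff w(1) u(1) by blast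
    then have "presentation_cong X R `` {w} = K"
      unfolding u(2) by (rule equiv_class_eq[OF equiv_presentation_cong])
    then show "K \<in> (\<lambda>K. presentation_cong X R `` {SOME w. w \<in> group_words X \<and> h w = K}) ` h ` group_words X"
      using u(1) unfolding w_def by blast
  qed
  ultimately show ?thesis by (rule finite_subset[rotated])
qed

lemma trivial_center:
  assumes triv: "group_center (presented_group Y R') = {\<one>\<^bsub>presented_group Y R'\<^esub>}"
    and z: "z \<in> group_center (presented_group X R)"
  shows "z = \<one>\<^bsub>presented_group X R\<^esub>"
proof -
  have carrier: "carrier (presented_group X R) = (\<lambda>w. presentation_cong X R `` {w}) ` group_words X"
    "carrier (presented_group Y R') = (\<lambda>w. presentation_cong Y R' `` {w}) ` group_words Y"
    by (auto simp: presented_group_def quotient_def)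
  have one: "\<one>\<^bsub>presented_group X R\<^esub> = presentation_cong X R `` {[]}"
    "\<one>\<^bsub>presented_group Y R'\<^esub> = presentation_cong Y R' `` {[]}"
    by (simp_all add: presented_group_def)
  from z obtain u where u: "u \<in> group_words X" "z = presentation_cong X R `` {u}"
    unfolding group_center_def carrier by blast
  note iffX = eq_equiv_class_iff[OF equiv_presentation_cong]
  have "presentation_cong Y R' `` {map (apfst f) u} \<in> group_center (presented_group Y R')"
    unfolding group_center_def carrier
  proof (intro CollectI conjI imageI ballI)
    show "map (apfst f) u \<in> group_words Y" using map_f_words u(1) .
    fix k assume "k \<in> (\<lambda>w. presentation_cong Y R' `` {w}) ` group_words Y"
    then obtain w where w: "w \<in> group_words Y" "k = presentation_cong Y R' `` {w}" by blast
    let ?w = "map (apfst g) w"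
    have wX: "?w \<in> group_words X" using map_g_words w(1) .
    have "presentation_cong X R `` {?w} \<in> carrier (presented_group X R)"
      unfolding carrier using wX by blast
    then have "z \<otimes>\<^bsub>presented_group X R\<^esub> presentation_cong X R `` {?w} =
        presentation_cong X R `` {?w} \<otimes>\<^bsub>presented_group X R\<^esub> z"
      using z unfolding group_center_def by blast
    then have "presentation_cong X R `` {u @ ?w} = presentation_cong X R `` {?w @ u}"
      by (simp only: u(2) presented_group_mult_class u(1) wX)
    then have "(u @ ?w, ?w @ u) \<in> presentation_cong X R"
      using iffX u(1) wX by (metis group_words_simps(3))
    from presentation_cong_map[OF f rel_f this]
    have "(map (apfst f) u @ w, w @ map (apfst f) u) \<in> presentation_cong Y R'"
      unfolding map_append map_f_g[OF w(1)] .
    then show "presentation_cong Y R' `` {map (apfst f) u} \<otimes>\<^bsub>presented_group Y R'\<^esub> k =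
        k \<otimes>\<^bsub>presented_group Y R'\<^esub> presentation_cong Y R' `` {map (apfst f) u}"
      using w map_f_words[OF u(1)] equiv_class_eq[OF equiv_presentation_cong]
      by (simp add: presented_group_mult_class)
  qed
  then have "presentation_cong Y R' `` {map (apfst f) u} = presentation_cong Y R' `` {map (apfst f) []}"
    unfolding triv one by simp
  then have "(map (apfst f) u, map (apfst f) []) \<in> presentation_cong Y R'"
    using iffX map_f_words[OF u(1)] by (metis list.simps(8) group_words_simps(1))
  then have "(u, []) \<in> presentation_cong X R" using map_f_cong_iff[OF u(1), of "[]"] by simp
  then show ?thesis unfolding u(2) one by (rule equiv_class_eq[OF equiv_presentation_cong])
qed

end

lemma artin_relations_map:
  assumes "f ` S \<subseteq> S'" "inj_on f S" "\<And>s t. s \<in> S \<Longrightarrow> t \<in> S \<Longrightarrow> M' (f s) (f t) = M s t"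
    and "(l, r) \<in> artin_relations S M"
  shows "(map (apfst f) l, map (apfst f) r) \<in> artin_relations S' M'"
proof -
  from assms(4) obtain s t m where st: "s \<in> S" "t \<in> S" "s \<noteq> t" "M s t = enat m"
    "l = alternating_word (s, True) (t, True) m" "r = alternating_word (t, True) (s, True) m"
    unfolding artin_relations_def by auto
  have "f s \<in> S'" "f t \<in> S'" "f s \<noteq> f t" "M' (f s) (f t) = enat m"
    using st assms(1-3) by (auto dest: inj_onD)
  then show ?thesis unfolding artin_relations_def st map_alternating_word by auto
qed

lemma coxeter_relations_map:
  assumes "f ` S \<subseteq> S'" "inj_on f S" "\<And>s t. s \<in> S \<Longrightarrow> t \<in> S \<Longrightarrow> M' (f s) (f t) = M s t"
    and "(l, r) \<in> coxeter_relations S M"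
  shows "(map (apfst f) l, map (apfst f) r) \<in> coxeter_relations S' M'"
  using assms(4) unfolding coxeter_relations_def
proof (elim UnE)
  assume "(l, r) \<in> {([(s, True), (s, True)], []) |s. s \<in> S}"
  then show "(map (apfst f) l, map (apfst f) r) \<in> {([(s, True), (s, True)], []) |s. s \<in> S'} \<union>
    {(concat (replicate m [(s, True), (t, True)]), []) |s t m. s \<in> S' \<and> t \<in> S' \<and> s \<noteq> t \<and> M' s t = enat m}"
    using assms(1) by auto
next
  assume "(l, r) \<in> {(concat (replicate m [(s, True), (t, True)]), []) |s t m.
    s \<in> S \<and> t \<in> S \<and> s \<noteq> t \<and> M s t = enat m}"
  then obtain s t m where st: "s \<in> S" "t \<in> S" "s \<noteq> t" "M s t = enat m"
    "l = concat (replicate m [(s, True), (t, True)])" "r = []" by auto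
  have "f s \<in> S'" "f t \<in> S'" "f s \<noteq> f t" "M' (f s) (f t) = enat m"
    using st assms(1-3) by (auto dest: inj_onD)
  then show "(map (apfst f) l, map (apfst f) r) \<in> {([(s, True), (s, True)], []) |s. s \<in> S'} \<union>
    {(concat (replicate m [(s, True), (t, True)]), []) |s t m. s \<in> S' \<and> t \<in> S' \<and> s \<noteq> t \<and> M' s t = enat m}"
    by (auto simp: st map_concat)
qed

section \<open>The reduction to graphs free of infinity\<close>

theorem theoremB:
  assumes "\<forall>(S :: nat set) M.
      coxeter_matrix S M \<and> coxeter_connected S M \<and> \<not> spherical_type S M \<and> free_of_infinity S M
      \<longrightarrow> group_center (artin_group S M) = {\<one>\<^bsub>artin_group S M\<^esub>}"
  shows "\<forall>(S :: 'a set) M.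
      coxeter_matrix S M \<and> coxeter_connected S M \<and> \<not> spherical_type S M
      \<longrightarrow> group_center (artin_group S M) = {\<one>\<^bsub>artin_group S M\<^esub>}"
proof (intro allI impI, elim conjE)
  fix S :: "'a set" and M
  assume S: "coxeter_matrix S M" "coxeter_connected S M" "\<not> spherical_type S M"
  interpret artin_tits "artin_group S M" S M
    using S(1) group_presented_group by (intro artin_tits.intro artin_tits_axioms.intro) (auto simp: artin_group_def)
  have "z = \<one>\<^bsub>artin_group S M\<^esub>" if z: "z \<in> group_center (artin_group S M)" for z
  proof (cases "free_of_infinity S M")
    case False
    then obtain s t where st: "s \<in> S" "t \<in> S" "s \<noteq> t" "M s t = \<infinity>"
      by (auto simp: free_of_infinity_def)
    from center_subset_base[OF this z] show ?thesis
      using st(1) by (intro center_inter_proper_parabolic[OF S(2) _ z]) auto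
  next
    case True
    obtain f :: "'a \<Rightarrow> nat" where f: "inj_on f S"
      using finite_imp_inj_to_nat_seg[OF finite_vertices] by blast
    define g where "g = inv_into S f"
    define S' where "S' = f ` S"
    define M' where "M' i j = M (g i) (g j)" for i j
    have gf: "g (f s) = s" if "s \<in> S" for s using inv_into_f_f[OF f that] by (simp add: g_def)
    have M': "M' (f s) (f t) = M s t" if "s \<in> S" "t \<in> S" for s t using that by (simp add: M'_def gf)
    have maps: "f ` S \<subseteq> S'" "g ` S' \<subseteq> S" by (auto simp: S'_def gf)
    have g: "inj_on g S'" unfolding g_def S'_def by (rule inj_on_inv_into) simp
    have fg: "f (g y) = y" if "y \<in> S'" for y using that by (auto simp: S'_def gf)
    have artin_f: "(map (apfst f) l, map (apfst f) r) \<in> artin_relations S' M'"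
      if "(l, r) \<in> artin_relations S M" for l r
      using maps(1) f M' that by (rule artin_relations_map)
    have artin_g: "(map (apfst g) l, map (apfst g) r) \<in> artin_relations S M"
      if "(l, r) \<in> artin_relations S' M'" for l r
      using maps(2) g M'_def[symmetric] that by (rule artin_relations_map)
    interpret artin: presentation_relabelling S S' "artin_relations S M" "artin_relations S' M'" f g
      using maps gf fg artin_f artin_g by unfold_locales
    have coxeter_f: "(map (apfst f) l, map (apfst f) r) \<in> coxeter_relations S' M'"
      if "(l, r) \<in> coxeter_relations S M" for l r
      using maps(1) f M' that by (rule coxeter_relations_map)
    have coxeter_g: "(map (apfst g) l, map (apfst g) r) \<in> coxeter_relations S M"
      if "(l, r) \<in> coxeter_relations S' M'" for l r
      using maps(2) g M'_def[symmetric] that by (rule coxeter_relations_map)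
    interpret coxeter: presentation_relabelling S S' "coxeter_relations S M" "coxeter_relations S' M'" f g
      using maps gf fg coxeter_f coxeter_g by unfold_locales
    have "coxeter_matrix S' M'"
      using S(1) f by (auto simp: coxeter_matrix_def S'_def M' inj_on_eq_iff)
    moreover have "coxeter_connected S' M'"
    proof -
      have "(f s, f t) \<in> (coxeter_edges S' M')\<^sup>*" if "(s, t) \<in> (coxeter_edges S M)\<^sup>*" for s t
        using that
      proof (induction rule: rtrancl_induct)
        case (step t u)
        then have "(f t, f u) \<in> coxeter_edges S' M'"
          using f by (auto simp: coxeter_edges_def S'_def M' inj_on_eq_iff)
        with step.IH show ?case by (rule rtrancl_into_rtrancl)
      qed simp
      then show ?thesis using S(2) by (auto simp: coxeter_connected_def S'_def)
    qed
    moreover have "\<not> spherical_type S' M'"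
      using S(3) coxeter.finite_carrier by (auto simp: spherical_type_def coxeter_group_def)
    moreover have "free_of_infinity S' M'"
      using True f by (auto simp: free_of_infinity_def S'_def M' inj_on_eq_iff)
    ultimately have "group_center (artin_group S' M') = {\<one>\<^bsub>artin_group S' M'\<^esub>}"
      using assms by blast
    from artin.trivial_center[OF this[unfolded artin_group_def]] z show ?thesis
      by (simp add: artin_group_def)
  qed
  moreover have "\<one>\<^bsub>artin_group S M\<^esub> \<in> group_center (artin_group S M)"
    by (simp add: group_center_def)
  ultimately show "group_center (artin_group S M) = {\<one>\<^bsub>artin_group S M\<^esub>}" by blast
qed

end
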